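(* Let $c, k \in \mathbb{N}$. For every $d \in \mathbb{N}$ let $\mathfrak{d}_1^d, \mathfrak{d}_2^d, \ldots, \mathfrak{d}_{k+1}^d \in [c d^c]$. For every $d \in \mathbb{N}$, $i \in [k]$ let $Q_i^d \subseteq [-c d^c, c d^c]^{\mathfrak{d}_i^d}$ be a ($\mathfrak{d}_i^d$-dimensional) hypercube and let $g_i^d \in C(Q_i^d, \mathbb{R}^{\mathfrak{d}_{i+1}^d})$ be a function. Let $p \in [1,\infty]$. Assume for every $d \in \mathbb{N}$, $i \in [k]$ that $$g_i^d \in \mathscr{P}_{c,p}(Q_i^d, c d^c) \cup \{ \mathfrak{m}_{\mathfrak{d}_i^d}|_{Q_i^d} \} \cup \{ \mathfrak{p}_{\mathfrak{d}_i^d}|_{Q_i^d} \} \cup \mathbf{M}(Q_i^d) \cup \mathbf{P}(Q_i^d).$$ Assume for all $d \in \mathbb{N}$, $i \in [k-1]$ that $g_i^d(Q_i^d) \subseteq Q_{i+1}^d$. Assume for all $d \in \mathbb{N}$, $i \in [k]$ with $g_i^d \in \mathbf{P}(Q_i^d) \cup \{ \mathfrak{p}_{\mathfrak{d}_i^d}|_{Q_i^d} \}$ that $Q_i^d \subseteq [-1,1]^{\mathfrak{d}_i^d}$. For every $d \in \mathbb{N}$ let $F_d \in C(Q_1^d, \mathbb{R}^{\mathfrak{d}_{k+1}^d})$ satisfy $F_d = g_k^d \circ g_{k-1}^d \circ \cdots \circ g_1^d$. Then there exists $K \in \mathbb{N}$ such that for every $d \in \mathbb{N}$, $\varepsilon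 \in (0,1]$ there exists $\Phi \in \mathbf{N}$ such that $\mathcal{R}(\Phi) \in C(\mathbb{R}^{\mathfrak{d}_1^d}, \mathbb{R}^{\mathfrak{d}_{k+1}^d})$, $$\mathcal{P}(\Phi) \le K d^K \varepsilon^{-2c}, \qquad \text{and} \qquad \forall\, x \in Q_1^d \colon \ \| \mathcal{R}(\Phi)(x) - F_d(x) \|_p \le \varepsilon .$$
   Context: Notation: $\mathbb{N} = \{1,2,\ldots\}$ and $[n] = \{1,2,\ldots,n\}$ for $n \in \mathbb{N} \cup \{0\}$ (so $[0]=\emptyset$). $C(X,Y)$ is the set of continuous functions from $X$ to $Y$. For $p \in [1,\infty]$, $\|\cdot\|_p$ is the usual $\ell_p$-norm on $\mathbb{R}^d$. Neural networks: $\mathbf{N} = \bigcup_{L \in \mathbb{N}} \bigcup_{\ell_0, \ldots, \ell_L \in \mathbb{N}} \prod_{k=1}^L (\mathbb{R}^{\ell_k \times \ell_{k-1}} \times \mathbb{R}^{\ell_k})$ is the set of deep neural networks. Let $\mathfrak{r}$ be the componentwise ReLU, $\mathfrak{r}(x_1,\ldots,x_d) = (\max\{x_1,0\},\ldots,\max\{x_d,0\})$. For $\Phi = ((W_1,b_1),\ldots,(W_L,b_L)) \in \prod_{k=1}^L (\mathbb{R}^{\ell_k\times\ell_{k-1}} \times \mathbb{R}^{\ell_k})$ put $\mathcal{A}_i^\Phi(x) = W_i x + b_i$; the realization $\mathcal{R}(\Phi) \in C(\mathbb{R}^{\ell_0}, \mathbb{R}^{\ell_L})$ is $\mathcal{R}(\Phi)(x)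 = \mathcal{A}_L^\Phi(\mathfrak{r}(\mathcal{A}_{L-1}^\Phi(\mathfrak{r}(\cdots \mathfrak{r}(\mathcal{A}_1^\Phi(x)) \cdots))))$ (no activation after the last layer), and the number of parameters is $\mathcal{P}(\Phi) = \sum_{i=1}^L \ell_i(\ell_{i-1}+1)$. A ($d$-dimensional) hypercube is a set of the form $[a,b]^d \subseteq \mathbb{R}^d$ with $a \in \mathbb{R}$, $b \in (a,\infty)$. Parallelization: for $f_i \colon A_i \to \mathbb{R}^{e_i}$ with $A_i \subseteq \mathbb{R}^{d_i}$, $i \in [n]$, the function $f_1 \square \cdots \square f_n \colon A_1 \times \cdots \times A_n \to \mathbb{R}^{e_1+\cdots+e_n}$ is $(f_1 \square \cdots \square f_n)(x_1,\ldots,x_n) = (f_1(x_1),\ldots,f_n(x_n))$. For $d \in \mathbb{N}$, $x \in \mathbb{R}^d$ let $m_d(x) = \max\{x_1,\ldots,x_d\}$, $p_d(x) = \prod_{i=1}^d x_i$, and let $\mathfrak{m}_d, \mathfrak{p}_d \colon \mathbb{R}^d \to \mathbb{R}^d$ be $\mathfrak{m}_d(x) = (m_1(x_1), m_2(x_1,x_2), \ldots, m_d(x_1,\ldots,x_d))$ and $\mathfrak{p}_d(x) = (p_1(x_1), p_2(x_1,x_2), \ldots, p_d(x_1,\ldots,x_d))$. Function classes: let $Q = [a,b]^d$ be a hypercube. - For $k \in \mathbb{N}$, $p \in [1,\infty]$, $L \in [0,\infty)$, $\mathscr{P}_{k,p}(Q,L)$ is the set of all continuous functions $f$ on $Q$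 for which there exist $n, d_1,\ldots,d_n \in \mathbb{N}$ and functions $f_i \colon [a,b]^{d_i} \to \mathbb{R}$, $i \in [n]$, with $\sum_{i=1}^n d_i = d$, $\max_{i} d_i \le k$, $|f_i(x)-f_i(y)| \le L\|x-y\|_p$ for all $i \in [n]$, $x,y \in [a,b]^{d_i}$, and $f = f_1 \square \cdots \square f_n$. - $\mathbf{M}(Q)$ is the set of all functions on $Q$ of the form $m_{d_1}|_{[a,b]^{d_1}} \square \cdots \square m_{d_n}|_{[a,b]^{d_n}}$ with $n, d_1,\ldots,d_n \in \mathbb{N}$, $\sum_i d_i = d$. - $\mathbf{P}(Q)$ is the set of all functions on $Q$ of the form $p_{d_1}|_{[a,b]^{d_1}} \square \cdots \square p_{d_n}|_{[a,b]^{d_n}}$ with $n, d_1,\ldots,d_n \in \mathbb{N}$, $\sum_i d_i = d$. *)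

theory Defs
  imports "HOL-Analysis.Abstract_Euclidean_Space" "HOL-Library.Extended_Real"
    "Jordan_Normal_Form.Matrix"
begin

unbundle no vec_syntax

text \<open>
  The space of real $d$-vectors is \<^term>\<open>carrier_vec d :: real vec set\<close>. Coordinates are numbered
  from $0$. A function on a set $X$ of vectors is an extensional function on $X$, so that equality of
  functions on $X$ is equality in HOL.
\<close>

type_synonym rvec = "real vec"

definition lp_norm :: "ereal \<Rightarrow> rvec \<Rightarrow> real" where
  "lp_norm p x =
    (if p = \<infinity> then Max ((\<lambda>i. \<bar>x $ i\<bar>) ` {..<dim_vec x})
     else (\<Sum>i<dim_vec x. \<bar>x $ i\<bar> powr real_of_ereal p) powr (1 / real_of_ereal p))"

text \<open>
  The usual topology on $d$-vectors, transported from \<^const>\<open>Euclidean_space\<close>, whose points are the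
  sequences vanishing from index $d$ on.
\<close>

definition euclidean_vec :: "nat \<Rightarrow> rvec topology" where
  "euclidean_vec d =
    pullback_topology (carrier_vec d) (\<lambda>x i. if i < d then x $ i else 0) (Euclidean_space d)"

text \<open>The continuous functions from a set $X$ of $m$-vectors to the $n$-vectors.\<close>

definition cont_funs :: "nat \<Rightarrow> rvec set \<Rightarrow> nat \<Rightarrow> (rvec \<Rightarrow> rvec) set" where
  "cont_funs m X n =
    {f \<in> X \<rightarrow>\<^sub>E carrier_vec n.
      continuous_map (subtopology (euclidean_vec m) X) (euclidean_vec n) f}"


type_synonym network = "(real mat \<times> rvec) list"

text \<open>The layer widths are $\ell_0, \ldots, \ell_L$ where $L$ is the length of the list.\<close>

definition networks :: "network set" where
  "networks =
    {\<Phi>. \<Phi> \<noteq> [] \<and>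
      (\<exists>l :: nat \<Rightarrow> nat. (\<forall>i\<le>length \<Phi>. 1 \<le> l i) \<and>
        (\<forall>i<length \<Phi>. fst (\<Phi> ! i) \<in> carrier_mat (l (Suc i)) (l i) \<and>
                      snd (\<Phi> ! i) \<in> carrier_vec (l (Suc i))))}"

definition in_dim :: "network \<Rightarrow> nat" where
  "in_dim \<Phi> = dim_col (fst (hd \<Phi>))"

definition out_dim :: "network \<Rightarrow> nat" where
  "out_dim \<Phi> = dim_row (fst (last \<Phi>))"

definition num_params :: "network \<Rightarrow> nat" where
  "num_params \<Phi> = (\<Sum>(W, b)\<leftarrow>\<Phi>. dim_row W * (dim_col W + 1))"

definition relu :: "rvec \<Rightarrow> rvec" where
  "relu x = map_vec (\<lambda>t. max t 0) x"

definition affine :: "real mat \<times> rvec \<Rightarrow> rvec \<Rightarrow> rvec" where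
  "affine A x = fst A *\<^sub>v x + snd A"

fun eval_layers :: "network \<Rightarrow> rvec \<Rightarrow> rvec" where
  "eval_layers [] x = x"
| "eval_layers [A] x = affine A x"
| "eval_layers (A # B # \<Phi>) x = eval_layers (B # \<Phi>) (relu (affine A x))"

definition realization :: "network \<Rightarrow> rvec \<Rightarrow> rvec" where
  "realization \<Phi> = restrict (eval_layers \<Phi>) (carrier_vec (in_dim \<Phi>))"


definition hypercube :: "nat \<Rightarrow> real \<Rightarrow> real \<Rightarrow> rvec set" where
  "hypercube d a b = {x \<in> carrier_vec d. \<forall>i<d. a \<le> x $ i \<and> x $ i \<le> b}"

definition is_hypercube :: "nat \<Rightarrow> rvec set \<Rightarrow> bool" where
  "is_hypercube d Q \<longleftrightarrow> (\<exists>a b. a < b \<and> Q = hypercube d a b)"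

definition max_vec :: "rvec \<Rightarrow> real" where
  "max_vec x = Max ((\<lambda>i. x $ i) ` {..<dim_vec x})"

definition prod_vec :: "rvec \<Rightarrow> real" where
  "prod_vec x = (\<Prod>i<dim_vec x. x $ i)"

definition cum_max :: "rvec \<Rightarrow> rvec" where
  "cum_max x = vec (dim_vec x) (\<lambda>i. max_vec (vec_first x (Suc i)))"

definition cum_prod :: "rvec \<Rightarrow> rvec" where
  "cum_prod x = vec (dim_vec x) (\<lambda>i. prod_vec (vec_first x (Suc i)))"

text \<open>
  Block lengths $d_1, \ldots, d_n$ are kept in a list \<open>ds\<close>. The term \<open>parallel ds f\<close> is the
  parallelization of $n$ real-valued functions, the $i$-th of which takes $d_i$-vectors; all
  parallelizations used below have real-valued components.
\<close>

definition block_lengths :: "nat \<Rightarrow> nat list \<Rightarrow> bool" where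
  "block_lengths d ds \<longleftrightarrow> ds \<noteq> [] \<and> (\<forall>e\<in>set ds. 1 \<le> e) \<and> sum_list ds = d"

definition block :: "nat list \<Rightarrow> nat \<Rightarrow> rvec \<Rightarrow> rvec" where
  "block ds i x = vec (ds ! i) (\<lambda>j. x $ (sum_list (take i ds) + j))"

definition parallel :: "nat list \<Rightarrow> (nat \<Rightarrow> rvec \<Rightarrow> real) \<Rightarrow> rvec \<Rightarrow> rvec" where
  "parallel ds f x = vec (length ds) (\<lambda>i. f i (block ds i x))"

definition lip_class :: "nat \<Rightarrow> ereal \<Rightarrow> rvec set \<Rightarrow> real \<Rightarrow> (rvec \<Rightarrow> rvec) set" where
  "lip_class k p Q L =
    {g. \<exists>d a b ds f.
      a < b \<and> Q = hypercube d a b \<and> block_lengths d ds \<and> (\<forall>e\<in>set ds. e \<le> k) \<and>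
      (\<forall>i<length ds. \<forall>x\<in>hypercube (ds ! i) a b. \<forall>y\<in>hypercube (ds ! i) a b.
         \<bar>f i x - f i y\<bar> \<le> L * lp_norm p (x - y)) \<and>
      g = restrict (parallel ds f) Q \<and>
      g \<in> cont_funs d Q (length ds)}"

definition max_class :: "rvec set \<Rightarrow> (rvec \<Rightarrow> rvec) set" where
  "max_class Q =
    {g. \<exists>d a b ds.
      a < b \<and> Q = hypercube d a b \<and> block_lengths d ds \<and>
      g = restrict (parallel ds (\<lambda>_. max_vec)) Q}"

definition prod_class :: "rvec set \<Rightarrow> (rvec \<Rightarrow> rvec) set" where
  "prod_class Q =
    {g. \<exists>d a b ds.
      a < b \<and> Q = hypercube d a b \<and> block_lengths d ds \<and>
      g = restrict (parallel ds (\<lambda>_. prod_vec)) Q}"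

end

theory Submission
  imports Defs
begin

text \<open>
  A function that is Lipschitz in $e$ variables is approximated by a maximum of about
  $\varepsilon^{-e}$ cones centred at grid points. The maximum is evaluated sequentially: a straight-line
  program with few registers, each step of which assigns to one register an affine function plus a
  multiple of the rectifier of another affine function, becomes a deep network whose width is linear
  in the number of registers. Blocks are processed one after the other by the same program, so no
  parallelization of networks is needed. Multiplication on $[-1,1]^2$ and the binary maximum are
  themselves Lipschitz functions of two variables, and $2 \le 2c$ makes their cost
  $\varepsilon^{-2}$ acceptable; products and maxima of many variables are folds of these, with errors
  that only add up. The approximants are Lipschitz on the whole space, in the 1-norm, with constants
  polynomial in $d$, whence the errors of the $k$ layers accumulate by a polynomial factor only.
\<close>

section \<open>Composing networks\<close>

text \<open>The whole dependence on \<epsilon> is put into depth. Widths stay below a polynomial in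
  d, so the length of a network, multiplied by roughly the square of its width, bounds its number of
  parameters. The obstacle is that an approximate layer may send a point of its cube out of the next
  cube, where nothing is known about the next map. Hence an approximant is compared with itself at
  two points, and with the exact map only at exact intermediate values. Errors then obey e' \<le>
  \<Lambda> e + \<delta>, and since k is fixed, \<Lambda> ^ k is polynomial in d. The exponent p
  enters only through \<open>lp_norm_le_dist1\<close>, which reduces both the Lipschitz hypotheses
  and the claim to the 1-norm. Long products and maxima show no exponential loss because the binary
  operation is replaced by a function with Lipschitz constant 1, on an interval that the exact
  operation maps into itself; for products this interval is [-1,1], whence the assumption on their
  cubes.\<close>

inductive net :: "nat \<Rightarrow> nat \<Rightarrow> nat \<Rightarrow> network \<Rightarrow> bool" for w where
  net_single: "W \<in> carrier_mat n m \<Longrightarrow> b \<in> carrier_vec n \<Longrightarrow> 1 \<le> m \<Longrightarrow> m \<le> w \<Longrightarrow> 1 \<le> n \<Longrightarrow> n \<le> w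
    \<Longrightarrow> net w m n [(W, b)]"
| net_Cons: "W \<in> carrier_mat h m \<Longrightarrow> b \<in> carrier_vec h \<Longrightarrow> 1 \<le> m \<Longrightarrow> m \<le> w \<Longrightarrow> net w h n \<Phi>
    \<Longrightarrow> net w m n ((W, b) # \<Phi>)"

lemma net_dims: "net w m n \<Phi> \<Longrightarrow> \<Phi> \<noteq> [] \<and> 1 \<le> m \<and> m \<le> w \<and> 1 \<le> n \<and> n \<le> w \<and> in_dim \<Phi> = m \<and> out_dim \<Phi> = n"
  by (induction rule: net.induct) (auto simp: in_dim_def out_dim_def)

text \<open>\<open>networks\<close> asks for a function giving the layer widths. The induction also
  fixes \<open>l 0 = m\<close>, so that a new first layer can be prepended by
  \<open>case_nat m l\<close>.\<close>

lemma net_networks: "net w m n \<Phi> \<Longrightarrow> \<Phi> \<in> networks"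
proof -
  assume "net w m n \<Phi>"
  then have "\<exists>l. l 0 = m \<and> (\<forall>i\<le>length \<Phi>. 1 \<le> l i) \<and>
        (\<forall>i<length \<Phi>. fst (\<Phi> ! i) \<in> carrier_mat (l (Suc i)) (l i) \<and>
                      snd (\<Phi> ! i) \<in> carrier_vec (l (Suc i)))"
  proof (induction rule: net.induct)
    case (net_single W n m b)
    then show ?case
      by (intro exI[of _ "\<lambda>i. if i = 0 then m else n"]) auto
  next
    case (net_Cons W h m b n \<Phi>)
    then obtain l where l: "l 0 = h" "\<forall>i\<le>length \<Phi>. 1 \<le> l i"
        "\<forall>i<length \<Phi>. fst (\<Phi> ! i) \<in> carrier_mat (l (Suc i)) (l i) \<and> snd (\<Phi> ! i) \<in> carrier_vec (l (Suc i))"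
      by blast
    show ?case
      using l net_Cons by (intro exI[of _ "case_nat m l"]) (auto split: nat.splits simp: nth_Cons')
  qed
  then show ?thesis
    using net_dims[OF \<open>net w m n \<Phi>\<close>] by (auto simp: networks_def)
qed

lemma net_num_params: "net w m n \<Phi> \<Longrightarrow> num_params \<Phi> \<le> length \<Phi> * (w * (w + 1))"
proof (induction rule: net.induct)
  case (net_single W n m b)
  then have "n * (m + 1) \<le> w * (w + 1)" by (intro mult_mono) auto
  with net_single show ?case by (auto simp: num_params_def)
next
  case (net_Cons W h m b n \<Phi>)
  then have "h * (m + 1) \<le> w * (w + 1)"
    using net_dims[OF \<open>net w h n \<Phi>\<close>] by (intro mult_mono) auto
  with net_Cons show ?case by (auto simp: num_params_def)
qed

lemma affine_carrier:
  "W \<in> carrier_mat n m \<Longrightarrow> b \<in> carrier_vec n \<Longrightarrow> x \<in> carrier_vec m \<Longrightarrow> affine (W, b) x \<in> carrier_vec n"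
  by (auto simp: affine_def)

lemma relu_carrier: "x \<in> carrier_vec n \<Longrightarrow> relu x \<in> carrier_vec n"
  by (auto simp: relu_def)

lemma eval_layers_Cons: "\<Phi> \<noteq> [] \<Longrightarrow> eval_layers (A # \<Phi>) x = eval_layers \<Phi> (relu (affine A x))"
  by (cases \<Phi>) auto

lemma eval_layers_carrier: "net w m n \<Phi> \<Longrightarrow> x \<in> carrier_vec m \<Longrightarrow> eval_layers \<Phi> x \<in> carrier_vec n"
proof (induction arbitrary: x rule: net.induct)
  case (net_single W n m b)
  then show ?case by (auto intro: affine_carrier)
next
  case (net_Cons W h m b n \<Phi>)
  then show ?case
    using net_dims[OF \<open>net w h n \<Phi>\<close>] by (auto simp: eval_layers_Cons intro!: relu_carrier affine_carrier)
qed

lemma affine_affine: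
  assumes "W \<in> carrier_mat h m" "b \<in> carrier_vec h" "V \<in> carrier_mat n h" "e \<in> carrier_vec n"
    "x \<in> carrier_vec m"
  shows "affine (V * W, V *\<^sub>v b + e) x = affine (V, e) (affine (W, b) x)"
proof -
  have "V *\<^sub>v (W *\<^sub>v x + b) = V *\<^sub>v (W *\<^sub>v x) + V *\<^sub>v b"
    using assms by (intro mult_add_distrib_mat_vec) auto
  moreover have "(V * W) *\<^sub>v x = V *\<^sub>v (W *\<^sub>v x)"
    using assms by (intro assoc_mult_mat_vec) auto
  ultimately show ?thesis
    using assms assoc_add_vec[of "V *\<^sub>v (W *\<^sub>v x)" n "V *\<^sub>v b" e] by (auto simp: affine_def)
qed

text \<open>No activation follows the last layer of \<Phi>, so its affine map can be merged with the
  first affine map of \<Psi>. No identity layer has to be inserted, and the width does not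
  grow.\<close>

lemma net_compose:
  assumes "net w m h \<Phi>" "net w h n \<Psi>"
  shows "\<exists>\<Omega>. net w m n \<Omega> \<and> length \<Omega> \<le> length \<Phi> + length \<Psi> \<and>
    (\<forall>x\<in>carrier_vec m. eval_layers \<Omega> x = eval_layers \<Psi> (eval_layers \<Phi> x))"
  using assms
proof (induction rule: net.induct)
  case (net_single W h m b)
  note 1 = net_single
  from \<open>net w h n \<Psi>\<close> show ?case
  proof (cases rule: net.cases)
    case (net_single V e)
    show ?thesis
      using 1 net_single
      by (intro exI[of _ "[(V * W, V *\<^sub>v b + e)]"] conjI ballI net.net_single)
        (auto simp: affine_affine[of W h m])
  next
    case (net_Cons V k e \<Psi>')
    have "\<Psi>' \<noteq> []" using net_dims net_Cons by blast
    then show ?thesis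
      using 1 net_Cons
      by (intro exI[of _ "(V * W, V *\<^sub>v b + e) # \<Psi>'"] conjI ballI net.net_Cons[of _ k])
        (auto simp: affine_affine[of W h m] eval_layers_Cons)
  qed
next
  case (net_Cons W l m b h \<Phi>)
  then obtain \<Omega> where \<Omega>: "net w l n \<Omega>" "length \<Omega> \<le> length \<Phi> + length \<Psi>"
    "\<forall>x\<in>carrier_vec l. eval_layers \<Omega> x = eval_layers \<Psi> (eval_layers \<Phi> x)" by blast
  have "\<Omega> \<noteq> []" "\<Phi> \<noteq> []" using net_dims net_Cons \<Omega> by blast+
  then show ?case
    using \<Omega> net_Cons
    by (intro exI[of _ "(W, b) # \<Omega>"] conjI ballI net.net_Cons[of _ l])
      (auto simp: eval_layers_Cons intro!: relu_carrier affine_carrier)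
qed

section \<open>Continuity of realizations\<close>

lemma topspace_euclidean_vec: "topspace (euclidean_vec n) = carrier_vec n"
  by (auto simp: euclidean_vec_def topspace_pullback_topology topspace_Euclidean_space)

lemma continuous_map_euclidean_vec:
  assumes "f \<in> topspace X \<rightarrow> carrier_vec n"
    and "\<And>i. i < n \<Longrightarrow> continuous_map X euclideanreal (\<lambda>x. f x $ i)"
  shows "continuous_map X (euclidean_vec n) f"
  unfolding euclidean_vec_def
proof (rule continuous_map_pullback')
  show "continuous_map X (Euclidean_space n) ((\<lambda>x i. if i < n then x $ i else 0) \<circ> f)"
    unfolding o_def using assms(2) by (subst continuous_map_componentwise_Euclidean_space) auto
  show "topspace X \<subseteq> f -` carrier_vec n" using assms(1) by auto
qed

lemma continuous_map_vec_index:
  assumes "i < n" shows "continuous_map (euclidean_vec n) euclideanreal (\<lambda>x. x $ i)"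
proof -
  \<comment> \<open>This is the identity in disguise, as points of \<open>Euclidean_space n\<close>
    vanish from index n on. In this form the componentwise criterion yields each coordinate
    projection.\<close>
  have "continuous_map (Euclidean_space n) (Euclidean_space n) (\<lambda>x i. if i < n then x i else 0)"
    by (rule continuous_map_eq[OF continuous_map_id]) (auto simp: topspace_Euclidean_space)
  then have "continuous_map (Euclidean_space n) euclideanreal (\<lambda>x. x i)"
    using assms by (subst (asm) continuous_map_componentwise_Euclidean_space) auto
  from continuous_map_pullback[OF this, of "carrier_vec n" "\<lambda>x i. if i < n then x $ i else 0"]
  show ?thesis using assms by (simp add: euclidean_vec_def o_def)
qed

lemma continuous_map_affine:
  assumes "W \<in> carrier_mat n m" "b \<in> carrier_vec n"
  shows "continuous_map (euclidean_vec m) (euclidean_vec n) (affine (W, b))"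
proof (rule continuous_map_euclidean_vec)
  show "affine (W, b) \<in> topspace (euclidean_vec m) \<rightarrow> carrier_vec n"
    using assms by (auto simp: topspace_euclidean_vec intro: affine_carrier)
  fix i assume i: "i < n"
  have "continuous_map (euclidean_vec m) euclideanreal (\<lambda>x. (\<Sum>j = 0..<m. W $$ (i, j) * x $ j) + b $ i)"
    by (intro continuous_intros continuous_map_vec_index) auto
  then show "continuous_map (euclidean_vec m) euclideanreal (\<lambda>x. affine (W, b) x $ i)"
    by (rule continuous_map_eq) (use assms i in \<open>auto simp: affine_def topspace_euclidean_vec scalar_prod_def\<close>)
qed

lemma continuous_map_relu: "continuous_map (euclidean_vec n) (euclidean_vec n) relu"
proof (rule continuous_map_euclidean_vec)
  show "relu \<in> topspace (euclidean_vec n) \<rightarrow> carrier_vec n"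
    by (auto simp: topspace_euclidean_vec intro: relu_carrier)
  fix i assume i: "i < n"
  have "continuous_map (euclidean_vec n) euclideanreal (\<lambda>x. max (x $ i) 0)"
    using i by (intro continuous_intros continuous_map_vec_index) auto
  then show "continuous_map (euclidean_vec n) euclideanreal (\<lambda>x. relu x $ i)"
    by (rule continuous_map_eq) (use i in \<open>auto simp: relu_def topspace_euclidean_vec\<close>)
qed

lemma continuous_map_eval_layers:
  "net w m n \<Phi> \<Longrightarrow> continuous_map (euclidean_vec m) (euclidean_vec n) (eval_layers \<Phi>)"
proof (induction rule: net.induct)
  case (net_single W n m b)
  then show ?case by (simp add: continuous_map_affine)
next
  case (net_Cons W h m b n \<Phi>)
  have "\<Phi> \<noteq> []" using net_dims net_Cons by blast
  then show ?case
    using continuous_map_compose[OF continuous_map_compose[OF continuous_map_affine continuous_map_relu] net_Cons.IH]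
      net_Cons by (simp add: o_def eval_layers_Cons)
qed

lemma realization_cont_funs:
  assumes "net w m n \<Phi>"
  shows "realization \<Phi> \<in> cont_funs m (carrier_vec m) n"
proof -
  have m: "in_dim \<Phi> = m" using net_dims[OF assms] by simp
  have "continuous_map (euclidean_vec m) (euclidean_vec n) (realization \<Phi>)"
    by (rule continuous_map_eq[OF continuous_map_eval_layers[OF assms]])
      (auto simp: realization_def m topspace_euclidean_vec)
  then have "continuous_map (subtopology (euclidean_vec m) (carrier_vec m)) (euclidean_vec n) (realization \<Phi>)"
    by (rule continuous_map_from_subtopology)
  then show ?thesis
    using eval_layers_carrier[OF assms] by (auto simp: cont_funs_def realization_def m)
qed

text \<open>Hides the network behind the function it computes and keeps only a width bound and a
  depth bound. These two suffice for the parameter count at the end.\<close>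

definition net_fun :: "nat \<Rightarrow> nat \<Rightarrow> nat \<Rightarrow> nat \<Rightarrow> (rvec \<Rightarrow> rvec) \<Rightarrow> bool" where
  "net_fun w m n N f \<longleftrightarrow>
    (\<exists>\<Phi>. net w m n \<Phi> \<and> length \<Phi> \<le> N \<and> (\<forall>x\<in>carrier_vec m. eval_layers \<Phi> x = f x))"

lemma net_fun_compose:
  assumes "net_fun w m h M f" "net_fun w h n N g"
  shows "net_fun w m n (M + N) (\<lambda>x. g (f x))"
proof -
  obtain \<Phi> \<Psi> where 1: "net w m h \<Phi>" "length \<Phi> \<le> M" "\<forall>x\<in>carrier_vec m. eval_layers \<Phi> x = f x"
    "net w h n \<Psi>" "length \<Psi> \<le> N" "\<forall>x\<in>carrier_vec h. eval_layers \<Psi> x = g x"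
    using assms unfolding net_fun_def by blast
  obtain \<Omega> where "net w m n \<Omega>" "length \<Omega> \<le> length \<Phi> + length \<Psi>"
    "\<forall>x\<in>carrier_vec m. eval_layers \<Omega> x = eval_layers \<Psi> (eval_layers \<Phi> x)"
    using net_compose[OF 1(1,4)] by blast
  then show ?thesis
    using 1 eval_layers_carrier[OF 1(1)] unfolding net_fun_def
    by (intro exI[of _ \<Omega>]) (fastforce)
qed

lemma net_width_mono: "net w m n \<Phi> \<Longrightarrow> w \<le> v \<Longrightarrow> net v m n \<Phi>"
  by (induction rule: net.induct) (auto intro: net.intros)

lemma net_fun_width_mono: "net_fun w m n N f \<Longrightarrow> w \<le> v \<Longrightarrow> net_fun v m n N f"
  unfolding net_fun_def using net_width_mono by blast

lemma net_fun_carrier: "net_fun w m n N f \<Longrightarrow> x \<in> carrier_vec m \<Longrightarrow> f x \<in> carrier_vec n"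
  unfolding net_fun_def using eval_layers_carrier by metis

section \<open>Register programs\<close>

text \<open>States are total functions on the naturals. Since the formula must hold for every state,
  the functional can read only the first s registers.\<close>

definition affine_functional :: "nat \<Rightarrow> ((nat \<Rightarrow> real) \<Rightarrow> real) \<Rightarrow> bool" where
  "affine_functional s l \<longleftrightarrow> (\<exists>w b. \<forall>\<sigma>. l \<sigma> = (\<Sum>i<s. w i * \<sigma> i) + b)"

lemma affine_functional_const: "affine_functional s (\<lambda>_. b)"
  unfolding affine_functional_def by (intro exI[of _ "\<lambda>_. 0"] exI[of _ b]) simp

lemma affine_functional_proj: "j < s \<Longrightarrow> affine_functional s (\<lambda>\<sigma>. \<sigma> j)"
  unfolding affine_functional_def
  by (intro exI[of _ "\<lambda>i. if i = j then 1 else 0"] exI[of _ 0]) (simp add: if_distrib[where f = "\<lambda>u. u * _"] cong: if_cong)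

lemma affine_functional_add:
  assumes "affine_functional s l" "affine_functional s l'"
  shows "affine_functional s (\<lambda>\<sigma>. l \<sigma> + l' \<sigma>)"
proof -
  obtain w b w' b' where "\<And>\<sigma>. l \<sigma> = (\<Sum>i<s. w i * \<sigma> i) + b" "\<And>\<sigma>. l' \<sigma> = (\<Sum>i<s. w' i * \<sigma> i) + b'"
    using assms unfolding affine_functional_def by metis
  then show ?thesis
    unfolding affine_functional_def
    by (intro exI[of _ "\<lambda>i. w i + w' i"] exI[of _ "b + b'"]) (simp add: algebra_simps sum.distrib)
qed

lemma affine_functional_scale:
  assumes "affine_functional s l"
  shows "affine_functional s (\<lambda>\<sigma>. a * l \<sigma>)"
proof -
  obtain w b where "\<And>\<sigma>. l \<sigma> = (\<Sum>i<s. w i * \<sigma> i) + b"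
    using assms unfolding affine_functional_def by metis
  then show ?thesis
    unfolding affine_functional_def
    by (intro exI[of _ "\<lambda>i. a * w i"] exI[of _ "a * b"]) (simp add: algebra_simps sum_distrib_left)
qed

lemma affine_functional_uminus: "affine_functional s l \<Longrightarrow> affine_functional s (\<lambda>\<sigma>. - l \<sigma>)"
  using affine_functional_scale[of s l "-1"] by simp

lemma affine_functional_diff:
  "affine_functional s l \<Longrightarrow> affine_functional s l' \<Longrightarrow> affine_functional s (\<lambda>\<sigma>. l \<sigma> - l' \<sigma>)"
  using affine_functional_add[OF _ affine_functional_uminus, of s l l'] by simp

lemmas affine_functional_intros = affine_functional_const affine_functional_proj affine_functional_add
  affine_functional_scale affine_functional_uminus affine_functional_diff

section \<open>From vectors to register states, and from programs to networks\<close>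

definition vec_state :: "nat \<Rightarrow> rvec \<Rightarrow> nat \<Rightarrow> real" where
  "vec_state m x i = (if i < m then x $ i else 0)"

lemma affine_functionals_layer:
  assumes "\<And>i. i < n \<Longrightarrow> affine_functional m (l i)"
  shows "\<exists>W b. W \<in> carrier_mat n m \<and> b \<in> carrier_vec n \<and>
    (\<forall>x\<in>carrier_vec m. affine (W, b) x = vec n (\<lambda>i. l i (vec_state m x)))"
proof -
  have "\<forall>i\<in>{..<n}. \<exists>w b. \<forall>\<sigma>. l i \<sigma> = (\<Sum>j<m. w j * \<sigma> j) + b"
    using assms by (auto simp: affine_functional_def)
  then obtain w b where wb: "\<And>i \<sigma>. i < n \<Longrightarrow> l i \<sigma> = (\<Sum>j<m. w i j * \<sigma> j) + b i"
    unfolding bchoice_iff Ball_def lessThan_iff by metis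
  show ?thesis
  proof (intro exI[of _ "mat n m (\<lambda>(i, j). w i j)"] exI[of _ "vec n b"] conjI ballI)
    fix x :: rvec assume x: "x \<in> carrier_vec m"
    show "affine (mat n m (\<lambda>(i, j). w i j), vec n b) x = vec n (\<lambda>i. l i (vec_state m x))"
      using x by (intro eq_vecI)
        (auto simp: affine_def wb scalar_prod_def vec_state_def lessThan_atLeast0 intro!: sum.cong)
  qed auto
qed

lemma net_fun_affine:
  assumes "1 \<le> m" "m \<le> w" "1 \<le> n" "n \<le> w" "\<And>i. i < n \<Longrightarrow> affine_functional m (l i)"
  shows "net_fun w m n 1 (\<lambda>x. vec n (\<lambda>i. l i (vec_state m x)))"
proof -
  obtain W b where "W \<in> carrier_mat n m" "b \<in> carrier_vec n"
    "\<forall>x\<in>carrier_vec m. affine (W, b) x = vec n (\<lambda>i. l i (vec_state m x))"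
    using affine_functionals_layer[of n m l] assms(5) by blast
  then show ?thesis
    using assms(1-4) unfolding net_fun_def by (intro exI[of _ "[(W, b)]"]) (auto intro: net_single)
qed

text \<open>The affine part \<open>p i\<close> passes through the hidden layer as \<open>t = relu t - relu (- t)\<close>.\<close>

lemma net_fun_relu_layer:
  assumes "1 \<le> m" "m \<le> w" "1 \<le> n" "3 * n \<le> w"
    and p: "\<And>i. i < n \<Longrightarrow> affine_functional m (p i)"
    and q: "\<And>i. i < n \<Longrightarrow> affine_functional m (q i)"
  shows "net_fun w m n 2 (\<lambda>x. vec n (\<lambda>i. p i (vec_state m x) + a i * max 0 (q i (vec_state m x))))"
proof -
  define h where "h r = (if r < n then p r else if r < 2 * n then (\<lambda>\<sigma>. - p (r - n) \<sigma>) else q (r - 2 * n))" for r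
  have "affine_functional m (h r)" if "r < 3 * n" for r
    using that p q by (auto simp: h_def intro!: affine_functional_intros)
  then obtain W b where W: "W \<in> carrier_mat (3 * n) m" "b \<in> carrier_vec (3 * n)"
    "\<And>x. x \<in> carrier_vec m \<Longrightarrow> affine (W, b) x = vec (3 * n) (\<lambda>i. h i (vec_state m x))"
    using affine_functionals_layer[of "3 * n" m h] by auto
  have "affine_functional (3 * n) (\<lambda>\<sigma>. \<sigma> i - \<sigma> (n + i) + a i * \<sigma> (2 * n + i))" if "i < n" for i
    using that by (intro affine_functional_intros) auto
  then obtain V e where V: "V \<in> carrier_mat n (3 * n)" "e \<in> carrier_vec n"
    "\<And>x. x \<in> carrier_vec (3 * n) \<Longrightarrow> affine (V, e) x =
      vec n (\<lambda>i. vec_state (3 * n) x i - vec_state (3 * n) x (n + i) + a i * vec_state (3 * n) x (2 * n + i))"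
    using affine_functionals_layer[of n "3 * n" "\<lambda>i \<sigma>. \<sigma> i - \<sigma> (n + i) + a i * \<sigma> (2 * n + i)"] by blast
  have "net w m n [(W, b), (V, e)]"
    using W V assms(1-4) by (intro net_Cons[of _ "3 * n"] net_single) auto
  moreover have "eval_layers [(W, b), (V, e)] x =
      vec n (\<lambda>i. p i (vec_state m x) + a i * max 0 (q i (vec_state m x)))" if x: "x \<in> carrier_vec m" for x
  proof -
    have "relu (affine (W, b) x) \<in> carrier_vec (3 * n)"
      using x W by (intro relu_carrier) auto
    then show ?thesis
      unfolding eval_layers.simps
      by (intro eq_vecI) (auto simp: V W x vec_state_def relu_def h_def max_def)
  qed
  ultimately show ?thesis
    unfolding net_fun_def by (intro exI[of _ "[(W, b), (V, e)]"]) auto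
qed

text \<open>The index counts assignments, each of which will cost at most two layers. The number of
  registers s is fixed once and for all and determines the width alone.\<close>

inductive prog :: "nat \<Rightarrow> nat \<Rightarrow> ((nat \<Rightarrow> real) \<Rightarrow> nat \<Rightarrow> real) \<Rightarrow> bool" for s where
  prog_skip: "prog s 0 (\<lambda>\<sigma>. \<sigma>)"
| prog_step: "prog s N T \<Longrightarrow> j < s \<Longrightarrow> affine_functional s p \<Longrightarrow> affine_functional s q
    \<Longrightarrow> prog s (Suc N) (\<lambda>\<sigma>. (T \<sigma>)(j := p (T \<sigma>) + a * max 0 (q (T \<sigma>))))"

lemma prog_compose: "prog s N U \<Longrightarrow> prog s M T \<Longrightarrow> prog s (M + N) (\<lambda>\<sigma>. U (T \<sigma>))"
proof (induction rule: prog.induct)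
  case (prog_step N U j p q a)
  then show ?case using prog.prog_step[of s "M + N" "\<lambda>\<sigma>. U (T \<sigma>)" j p q a] by (simp add: fun_upd_def)
qed simp

lemma prog_assign:
  "j < s \<Longrightarrow> affine_functional s p \<Longrightarrow> affine_functional s q
    \<Longrightarrow> prog s 1 (\<lambda>\<sigma>. \<sigma>(j := p \<sigma> + a * max 0 (q \<sigma>)))"
  using prog_step[OF prog_skip] by simp

lemma prog_assign_affine: "j < s \<Longrightarrow> affine_functional s p \<Longrightarrow> prog s 1 (\<lambda>\<sigma>. \<sigma>(j := p \<sigma>))"
  using prog_assign[of j s p "\<lambda>_. 0" 0] affine_functional_const by simp

text \<open>A maximum costs a single step since max(x, y) = x + max(0, y - x).\<close>

lemma prog_assign_max:
  "j < s \<Longrightarrow> t < s \<Longrightarrow> prog s 1 (\<lambda>\<sigma>. \<sigma>(j := max (\<sigma> j) (\<sigma> t)))"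
proof -
  assume "j < s" "t < s"
  then have "prog s 1 (\<lambda>\<sigma>. \<sigma>(j := \<sigma> j + 1 * max 0 (\<sigma> t - \<sigma> j)))"
    by (intro prog_assign affine_functional_intros)
  moreover have "x + 1 * max 0 (y - x) = max x y" for x y :: real by simp
  ultimately show ?thesis by (simp only:)
qed

text \<open>One assignment becomes one rectifier layer that updates register j and copies all
  others, with coefficient 0 in front of their rectifier. The extra layer loads the input and sets
  the remaining registers to 0.\<close>

lemma net_fun_prog:
  assumes "prog s N T" "1 \<le> m" "m \<le> s" "3 * s \<le> w"
  shows "net_fun w m s (2 * N + 1) (\<lambda>x. vec s (T (vec_state m x)))"
  using assms
proof (induction rule: prog.induct)
  case prog_skip
  have "net_fun w m s 1 (\<lambda>x. vec s (\<lambda>i. (if i < m then (\<lambda>\<sigma>. \<sigma> i) else (\<lambda>_. 0)) (vec_state m x)))"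
    using prog_skip by (intro net_fun_affine) (auto intro!: affine_functional_intros)
  moreover have "(\<lambda>x. vec s (\<lambda>i. (if i < m then (\<lambda>\<sigma>. \<sigma> i) else (\<lambda>_. 0)) (vec_state m x)))
      = (\<lambda>x. vec s (vec_state m x))"
    by (auto simp: vec_state_def intro!: ext eq_vecI)
  ultimately show ?case by simp
next
  case (prog_step N T j p q a)
  define P where "P i = (if i = j then p else (\<lambda>\<sigma>. \<sigma> i))" for i
  define A where "A i = (if i = j then a else 0)" for i
  have "net_fun w s s 2 (\<lambda>x. vec s (\<lambda>i. P i (vec_state s x) + A i * max 0 (q (vec_state s x))))"
    using prog_step by (intro net_fun_relu_layer) (auto simp: P_def intro!: affine_functional_intros)
  from net_fun_compose[OF prog_step.IH[OF prog_step.prems] this]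
  have "net_fun w m s (2 * Suc N + 1) (\<lambda>x. vec s (\<lambda>i. P i (vec_state s (vec s (T (vec_state m x)))) +
      A i * max 0 (q (vec_state s (vec s (T (vec_state m x)))))))"
    by (simp add: algebra_simps)
  \<comment> \<open>Between two layers the state is a vector of length s, so later registers are
    lost. An affine functional on s registers does not see this truncation.\<close>
  moreover have l: "l (vec_state s (vec s \<sigma>)) = l \<sigma>" if "affine_functional s l" for l \<sigma>
  proof -
    have "(\<Sum>i<s. w i * vec_state s (vec s \<sigma>) i) = (\<Sum>i<s. w i * \<sigma> i)" for w
      by (intro sum.cong) (auto simp: vec_state_def)
    then show ?thesis using that unfolding affine_functional_def by metis
  qed
  have "vec s (\<lambda>i. P i (vec_state s (vec s \<sigma>)) + A i * max 0 (q (vec_state s (vec s \<sigma>))))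
      = vec s (\<sigma>(j := p \<sigma> + a * max 0 (q \<sigma>)))" for \<sigma>
    using prog_step by (auto intro!: eq_vecI simp: P_def A_def l) (simp add: vec_state_def)
  ultimately show ?case by (simp add: fun_upd_def)
qed

text \<open>Inputs occupy the first m registers and results the next n. One more affine layer
  projects onto the results.\<close>

lemma net_fun_prog_outputs:
  assumes "prog s N T" "1 \<le> m" "1 \<le> n" "m + n \<le> s" "3 * s \<le> w"
  shows "net_fun w m n (2 * N + 2) (\<lambda>x. vec n (\<lambda>i. T (vec_state m x) (m + i)))"
proof -
  have "net_fun w s n 1 (\<lambda>x. vec n (\<lambda>i. vec_state s x (m + i)))"
    using assms by (intro net_fun_affine[of _ _ _ "\<lambda>i \<sigma>. \<sigma> (m + i)"]) (auto intro!: affine_functional_intros)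
  from net_fun_compose[OF net_fun_prog[OF assms(1,2) _ assms(5)] this]
  have "net_fun w m n (2 * N + 2) (\<lambda>x. vec n (\<lambda>i. vec_state s (vec s (T (vec_state m x))) (m + i)))"
    using assms by simp
  moreover have "vec n (\<lambda>i. vec_state s (vec s \<sigma>) (m + i)) = vec n (\<lambda>i. \<sigma> (m + i))" for \<sigma>
    using assms by (intro eq_vecI) (auto simp: vec_state_def)
  ultimately show ?thesis by simp
qed

section \<open>Lipschitz envelopes over a grid\<close>

text \<open>
  For an \<open>L\<close>-Lipschitz function \<open>f\<close> (in the 1-norm), the McShane type maximum below differs from \<open>f\<close>
  by at most \<open>2 L\<close> times the distance to the nearest point of \<open>Y\<close>, and it is \<open>L\<close>-Lipschitz on all of
  $R^e$, so that it tolerates arguments that have left the cube.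
\<close>

definition envelope ::
  "real \<Rightarrow> nat \<Rightarrow> ((nat \<Rightarrow> real) \<Rightarrow> real) \<Rightarrow> (nat \<Rightarrow> real) list \<Rightarrow> real \<Rightarrow> (nat \<Rightarrow> real) \<Rightarrow> real" where
  "envelope L e f Y r v = fold (\<lambda>y r. max r (f y - L * (\<Sum>i<e. \<bar>v i - y i\<bar>))) Y r"

lemma envelope_simps [simp]:
  "envelope L e f [] r v = r"
  "envelope L e f (y # Y) r v = envelope L e f Y (max r (f y - L * (\<Sum>i<e. \<bar>v i - y i\<bar>))) v"
  by (simp_all add: envelope_def)

lemma abs_max_diff_le: "\<bar>max a b - max a' b'\<bar> \<le> max \<bar>a - a'\<bar> \<bar>b - b'\<bar>" for a b :: real
  by linarith

lemma dist_sum_diff_le: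
  "\<bar>(\<Sum>i<e. \<bar>v i - y i\<bar>) - (\<Sum>i<e. \<bar>v' i - y i\<bar>)\<bar> \<le> (\<Sum>i<e. \<bar>v i - v' i\<bar>)" for v :: "nat \<Rightarrow> real"
proof -
  have "\<bar>(\<Sum>i<e. \<bar>v i - y i\<bar>) - (\<Sum>i<e. \<bar>v' i - y i\<bar>)\<bar> = \<bar>\<Sum>i<e. \<bar>v i - y i\<bar> - \<bar>v' i - y i\<bar>\<bar>"
    by (simp add: sum_subtractf)
  also have "\<dots> \<le> (\<Sum>i<e. \<bar>v i - v' i\<bar>)"
    by (rule order_trans[OF sum_abs sum_mono]) linarith
  finally show ?thesis .
qed

text \<open>Each cone is L-Lipschitz, and a maximum moves no more than the larger of the changes of
  its arguments. Two different start values are allowed because the accumulator itself depends on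
  the argument after the first point.\<close>

lemma envelope_lipschitz_start:
  assumes "0 \<le> L"
  shows "\<bar>envelope L e f Y r v - envelope L e f Y r' v'\<bar> \<le> max \<bar>r - r'\<bar> (L * (\<Sum>i<e. \<bar>v i - v' i\<bar>))"
proof (induction Y arbitrary: r r')
  case (Cons y Y)
  let ?S = "\<Sum>i<e. \<bar>v i - y i\<bar>" and ?S' = "\<Sum>i<e. \<bar>v' i - y i\<bar>"
  have "(f y - L * ?S) - (f y - L * ?S') = - (L * (?S - ?S'))" by (simp add: algebra_simps)
  then have "\<bar>(f y - L * ?S) - (f y - L * ?S')\<bar> = L * \<bar>?S - ?S'\<bar>"
    using assms by (simp only: abs_minus_cancel abs_mult abs_of_nonneg)
  also have "\<dots> \<le> L * (\<Sum>i<e. \<bar>v i - v' i\<bar>)"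
    using assms dist_sum_diff_le by (intro mult_left_mono) auto
  finally have "max \<bar>max r (f y - L * ?S) - max r' (f y - L * ?S')\<bar> (L * (\<Sum>i<e. \<bar>v i - v' i\<bar>))
      \<le> max \<bar>r - r'\<bar> (L * (\<Sum>i<e. \<bar>v i - v' i\<bar>))"
    by (intro max.boundedI max.cobounded2, intro order_trans[OF abs_max_diff_le] max.mono order_refl)
  with Cons[of "max r (f y - L * ?S)" "max r' (f y - L * ?S')"] show ?case
    unfolding envelope_simps by (rule order_trans)
qed simp

lemma envelope_lipschitz:
  "0 \<le> L \<Longrightarrow> \<bar>envelope L e f Y r v - envelope L e f Y r v'\<bar> \<le> L * (\<Sum>i<e. \<bar>v i - v' i\<bar>)"
  using envelope_lipschitz_start[of L e f Y r v r v'] by (simp add: sum_nonneg)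

lemma envelope_le:
  "r \<le> z \<Longrightarrow> (\<And>y. y \<in> set Y \<Longrightarrow> f y - L * (\<Sum>i<e. \<bar>v i - y i\<bar>) \<le> z) \<Longrightarrow> envelope L e f Y r v \<le> z"
  by (induction Y arbitrary: r) auto

lemma envelope_ge_start: "r \<le> envelope L e f Y r v"
proof (induction Y arbitrary: r)
  case (Cons y Y)
  show ?case using order_trans[OF max.cobounded1 Cons] by simp
qed simp

lemma envelope_ge: "y \<in> set Y \<Longrightarrow> f y - L * (\<Sum>i<e. \<bar>v i - y i\<bar>) \<le> envelope L e f Y r v"
proof (induction Y arbitrary: r)
  case (Cons z Y)
  then show ?case
    using order_trans[OF max.cobounded2 envelope_ge_start[of "max r (f y - L * (\<Sum>i<e. \<bar>v i - y i\<bar>))" L e f Y v]]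
    by auto
qed simp

section \<open>Grids in a cube and the number of points required\<close>

definition in_cube :: "nat \<Rightarrow> real \<Rightarrow> real \<Rightarrow> (nat \<Rightarrow> real) \<Rightarrow> bool" where
  "in_cube e a b v \<longleftrightarrow> (\<forall>i<e. a \<le> v i \<and> v i \<le> b)"

text \<open>Rounding down to the next grid point on the left is enough: an error of a full mesh
  instead of half a mesh only affects constants.\<close>

lemma grid_1d:
  fixes a b x :: real
  assumes "a < b" "1 \<le> N" "a \<le> x" "x \<le> b"
  shows "\<exists>k\<le>N. \<bar>x - (a + (b - a) * real k / real N)\<bar> \<le> (b - a) / real N"
proof -
  define z where "z = (x - a) * real N / (b - a)"
  define k where "k = nat \<lfloor>z\<rfloor>"
  have "0 \<le> z" using assms by (simp add: z_def)
  then have k: "real k \<le> z" "z \<le> real k + 1" unfolding k_def by linarith+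
  have "z \<le> real N"
    using assms by (simp add: z_def divide_le_eq mult.commute mult_left_mono)
  then have "k \<le> N" using k by linarith
  have x: "x = a + (b - a) * z / real N" using assms by (simp add: z_def)
  have "x - (a + (b - a) * real k / real N) = (b - a) / real N * (z - real k)"
    by (subst x) (simp add: algebra_simps diff_divide_distrib)
  moreover have "\<bar>(b - a) / real N * (z - real k)\<bar> \<le> (b - a) / real N * 1"
    using assms k by (subst abs_mult) (intro mult_mono, auto)
  ultimately show ?thesis using \<open>k \<le> N\<close> by auto
qed

lemma grid:
  fixes a b :: real
  assumes "a < b" "1 \<le> N"
  shows "\<exists>Y. length Y \<le> (N + 1) ^ e \<and> (\<forall>y\<in>set Y. in_cube e a b y) \<and>
    (\<forall>v. in_cube e a b v \<longrightarrow> (\<exists>y\<in>set Y. \<forall>i<e. \<bar>v i - y i\<bar> \<le> (b - a) / real N))"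
proof -
  define G where "G = (\<lambda>k. a + (b - a) * real k / real N) ` {..N}"
  have G: "finite G" "card G \<le> N + 1"
    using card_image_le[of "{..N}" "\<lambda>k. a + (b - a) * real k / real N"] by (auto simp: G_def)
  have G_bounds: "a \<le> y \<and> y \<le> b" if y: "y \<in> G" for y
  proof -
    obtain k where k: "k \<le> N" "y = a + (b - a) * real k / real N" using y by (auto simp: G_def)
    have "(b - a) * real k \<le> (b - a) * real N" using assms k by (intro mult_left_mono) auto
    then have "(b - a) * real k / real N \<le> b - a" using assms by (simp add: divide_le_eq)
    then show ?thesis using assms k by simp
  qed
  \<comment> \<open>Extensional functions make the e-fold product grid a finite set with exactly
    \<open>card G ^ e\<close> elements.\<close>
  obtain Y where Y: "set Y = ({..<e} \<rightarrow>\<^sub>E G)" "distinct Y"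
    using finite_distinct_list[OF finite_PiE[of "{..<e}" "\<lambda>_. G"]] G by auto
  have "length Y = card G ^ e"
    using distinct_card[OF Y(2)] Y(1) by (simp add: card_PiE)
  then have "length Y \<le> (N + 1) ^ e" using G by (simp add: power_mono)
  moreover have "\<exists>y\<in>set Y. \<forall>i<e. \<bar>v i - y i\<bar> \<le> (b - a) / real N" if v: "in_cube e a b v" for v
  proof -
    have "\<forall>i\<in>{..<e}. \<exists>y\<in>G. \<bar>v i - y\<bar> \<le> (b - a) / real N"
      using v grid_1d[OF assms] by (fastforce simp: in_cube_def G_def)
    then obtain y where y: "\<forall>i\<in>{..<e}. y i \<in> G \<and> \<bar>v i - y i\<bar> \<le> (b - a) / real N" by metis
    then show ?thesis
      by (intro bexI[of _ "restrict y {..<e}"]) (auto simp: Y)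
  qed
  ultimately show ?thesis
    using Y G_bounds by (intro exI[of _ Y]) (auto simp: in_cube_def PiE_def Pi_def)
qed

text \<open>On the cube every cone lies below f, so the maximum does too. From below, the cone at a
  nearby grid point y loses L |v - y| through its slope and as much again through the difference
  between f y and f v, in the 1-norm.\<close>

lemma lipschitz_envelope:
  fixes f :: "(nat \<Rightarrow> real) \<Rightarrow> real"
  assumes "a < b" "0 \<le> L" "0 < \<delta>"
    and lip: "\<And>v w. in_cube e a b v \<Longrightarrow> in_cube e a b w \<Longrightarrow> \<bar>f v - f w\<bar> \<le> L * (\<Sum>i<e. \<bar>v i - w i\<bar>)"
  shows "\<exists>Y r. real (length Y) \<le> (2 * L * real e * (b - a) / \<delta> + 3) ^ e \<and>
    (\<forall>v. in_cube e a b v \<longrightarrow> \<bar>envelope L e f Y r v - f v\<bar> \<le> \<delta>)"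
proof -
  \<comment> \<open>With N \<ge> X, each of the two losses is at most L e (b - a) / N \<le> \<delta>
    / 2.\<close>
  define X where "X = 2 * L * real e * (b - a) / \<delta>"
  have "0 \<le> X" using assms by (simp add: X_def)
  \<comment> \<open>The summand 1 keeps N positive even when X is 0. It is also the reason why N + 1
    is bounded by X + 3.\<close>
  define N where "N = nat \<lceil>X\<rceil> + 1"
  have N: "1 \<le> N" "X \<le> real N" "real N + 1 \<le> X + 3"
    using \<open>0 \<le> X\<close> unfolding N_def by linarith+
  obtain Y where Y: "length Y \<le> (N + 1) ^ e" "\<And>y. y \<in> set Y \<Longrightarrow> in_cube e a b y"
    "\<And>v. in_cube e a b v \<Longrightarrow> \<exists>y\<in>set Y. \<forall>i<e. \<bar>v i - y i\<bar> \<le> (b - a) / real N"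
    using grid[OF assms(1) N(1), of e] by blast
  \<comment> \<open>A lower bound for f on the whole cube: the value at a corner minus L times the
    1-norm diameter. The start value therefore never exceeds f.\<close>
  define r where "r = f (\<lambda>_. a) - L * (real e * (b - a))"
  have "real (length Y) \<le> real ((N + 1) ^ e)"
    using Y(1) by (simp only: of_nat_le_iff)
  also have "\<dots> = (real N + 1) ^ e" by (simp add: algebra_simps)
  also have "\<dots> \<le> (X + 3) ^ e" using N by (intro power_mono) auto
  finally have len: "real (length Y) \<le> (X + 3) ^ e" .
  have "\<bar>envelope L e f Y r v - f v\<bar> \<le> \<delta>" if v: "in_cube e a b v" for v
  proof -
    have "f y - L * (\<Sum>i<e. \<bar>v i - y i\<bar>) \<le> f v" if "y \<in> set Y" for y
      using lip[OF v Y(2)[OF that]] by linarith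
    moreover have "r \<le> f v"
    proof -
      have "(\<Sum>i<e. \<bar>v i - a\<bar>) \<le> (\<Sum>i<e. b - a)"
        using v by (intro sum_mono) (auto simp: in_cube_def)
      then have "L * (\<Sum>i<e. \<bar>v i - a\<bar>) \<le> L * (real e * (b - a))"
        using assms by (intro mult_left_mono) auto
      then show ?thesis
        using lip[OF v, of "\<lambda>_. a"] assms by (auto simp: r_def in_cube_def)
    qed
    ultimately have upper: "envelope L e f Y r v \<le> f v" by (intro envelope_le) auto
    obtain y where y: "y \<in> set Y" "\<forall>i<e. \<bar>v i - y i\<bar> \<le> (b - a) / real N" using Y(3)[OF v] by blast
    have "(\<Sum>i<e. \<bar>v i - y i\<bar>) \<le> (\<Sum>i<e. (b - a) / real N)" using y by (intro sum_mono) auto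
    then have "L * (\<Sum>i<e. \<bar>v i - y i\<bar>) \<le> L * (real e * ((b - a) / real N))"
      using assms by (intro mult_left_mono) auto
    also have "\<dots> = X * \<delta> / (2 * real N)" using assms by (simp add: X_def)
    also have "\<dots> \<le> \<delta> / 2" using N assms by (simp add: field_simps mult_right_mono)
    finally have "L * (\<Sum>i<e. \<bar>v i - y i\<bar>) \<le> \<delta> / 2" .
    then show ?thesis
      using upper lip[OF v Y(2)[OF y(1)]] envelope_ge[OF y(1), of f L v e r] by linarith
  qed
  with len show ?thesis unfolding X_def by blast
qed

text \<open>B bounds both the Lipschitz constant and half the side length. The 7 is 4 + 3: 4 from 2
  L e (b - a) \<le> 4 q B^2, and 3 absorbs the summand 3 of the point count. The factor q + 3 pays
  for at most q + 2 steps per grid point and for one initial step.\<close>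

definition grid_cost :: "nat \<Rightarrow> real \<Rightarrow> real \<Rightarrow> real" where
  "grid_cost q B \<delta> = (real q + 3) * (7 * real q * B ^ 2 / \<delta>) ^ q"

text \<open>The base of the power is at least 1, so the exponent e may be raised to q. This gives
  one cost for blocks of all lengths up to q.\<close>

lemma lipschitz_envelope_cost:
  fixes f :: "(nat \<Rightarrow> real) \<Rightarrow> real"
  assumes "a < b" "0 \<le> L" "0 < \<delta>" "\<delta> \<le> 1" "L \<le> B" "b - a \<le> 2 * B" "1 \<le> B" "e \<le> q" "1 \<le> q"
    and lip: "\<And>v w. in_cube e a b v \<Longrightarrow> in_cube e a b w \<Longrightarrow> \<bar>f v - f w\<bar> \<le> L * (\<Sum>i<e. \<bar>v i - w i\<bar>)"
  shows "\<exists>Y r. real (length Y * (e + 2) + 1) \<le> grid_cost q B \<delta> \<and>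
    (\<forall>v. in_cube e a b v \<longrightarrow> \<bar>envelope L e f Y r v - f v\<bar> \<le> \<delta>)"
proof -
  obtain Y r where Y: "real (length Y) \<le> (2 * L * real e * (b - a) / \<delta> + 3) ^ e"
    "\<And>v. in_cube e a b v \<Longrightarrow> \<bar>envelope L e f Y r v - f v\<bar> \<le> \<delta>"
    using lipschitz_envelope[OF assms(1-3) lip] by blast
  define V where "V = real q * B ^ 2 / \<delta>"
  define Z where "Z = 7 * real q * B ^ 2 / \<delta>"
  define X where "X = 2 * L * real e * (b - a) / \<delta>"
  have "L * real e * (b - a) \<le> B * real q * (2 * B)"
    using assms by (intro mult_mono) auto
  then have "X \<le> 4 * real q * B ^ 2 / \<delta>"
    unfolding X_def using assms by (intro divide_right_mono) (auto simp: power2_eq_square algebra_simps)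
  also have "\<dots> = 4 * V" by (simp add: V_def)
  finally have "X \<le> 4 * V" .
  moreover have "Z = 7 * V" by (simp add: V_def Z_def)
  moreover have "1 \<le> V"
  proof -
    have "1 * 1 \<le> real q * B ^ 2" using assms by (intro mult_mono) auto
    then show ?thesis using assms by (simp add: V_def)
  qed
  moreover have "0 \<le> X" using assms by (simp add: X_def)
  ultimately have Z: "0 \<le> X" "X + 3 \<le> Z" "1 \<le> Z" by linarith+
  have "real (length Y) \<le> Z ^ e"
    using Z by (intro order_trans[OF Y(1)[folded X_def]] power_mono) auto
  also have "\<dots> \<le> Z ^ q" using Z assms by (intro power_increasing) auto
  finally have "real (length Y) * real (e + 2) + 1 \<le> Z ^ q * real (q + 2) + Z ^ q"
    using assms Z by (intro add_mono mult_mono) auto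
  then have "real (length Y * (e + 2) + 1) \<le> grid_cost q B \<delta>"
    by (simp add: grid_cost_def Z_def algebra_simps)
  with Y(2) show ?thesis by blast
qed

text \<open>Since |z| = 2 max(0, z) - z, each coordinate is handled by one assignment to t.\<close>

lemma prog_subtract_dist:
  assumes "t < s" "\<And>i. i < e \<Longrightarrow> js i < s \<and> js i \<noteq> t"
  shows "prog s e (\<lambda>\<sigma>. \<sigma>(t := \<sigma> t - L * (\<Sum>i<e. \<bar>\<sigma> (js i) - y i\<bar>)))"
  using assms
proof (induction e)
  case 0
  show ?case using prog_skip[of s] by simp
next
  case (Suc e)
  let ?T = "\<lambda>\<sigma>. \<sigma>(t := \<sigma> t - L * (\<Sum>i<e. \<bar>\<sigma> (js i) - y i\<bar>))"
  have "prog s (Suc e) (\<lambda>\<sigma>. (?T \<sigma>)(t := ?T \<sigma> t + L * (?T \<sigma> (js e) - y e) +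
      (- 2 * L) * max 0 (?T \<sigma> (js e) - y e)))"
    using Suc.IH Suc.prems by (intro prog_step[of s e ?T t "\<lambda>\<sigma>. \<sigma> t + L * (\<sigma> (js e) - y e)" "\<lambda>\<sigma>. \<sigma> (js e) - y e"]
      affine_functional_intros) (simp_all del: fun_upd_apply)
  moreover have "(?T \<sigma>)(t := ?T \<sigma> t + L * (?T \<sigma> (js e) - y e) + (- 2 * L) * max 0 (?T \<sigma> (js e) - y e))
      = \<sigma>(t := \<sigma> t - L * (\<Sum>i<Suc e. \<bar>\<sigma> (js i) - y i\<bar>))" for \<sigma>
    using Suc.prems by (auto simp: fun_eq_iff algebra_simps abs_if max_def)
  ultimately show ?case by (simp only:)
qed

text \<open>f enters only through its values at the points of Y, which are constants of the program.
  Each point takes one step to load \<open>f y\<close> into t, e steps to subtract the distance and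
  one step for the maximum with u. The argument registers \<open>js i\<close> avoid t and u, so they
  survive for the next point.\<close>

lemma prog_envelope:
  assumes "u < s" "t < s" "u \<noteq> t" "\<And>i. i < e \<Longrightarrow> js i < s \<and> js i \<noteq> t \<and> js i \<noteq> u"
  shows "\<exists>T. prog s (length Y * (e + 2)) T \<and>
    (\<forall>\<sigma>. T \<sigma> u = envelope L e f Y (\<sigma> u) (\<lambda>i. \<sigma> (js i)) \<and> (\<forall>r. r \<noteq> u \<longrightarrow> r \<noteq> t \<longrightarrow> T \<sigma> r = \<sigma> r))"
proof (induction Y)
  case Nil
  show ?case using prog_skip[of s] by (intro exI[of _ "\<lambda>\<sigma>. \<sigma>"]) simp
next
  case (Cons y Y)
  then obtain T where T: "prog s (length Y * (e + 2)) T"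
    "\<And>\<sigma>. T \<sigma> u = envelope L e f Y (\<sigma> u) (\<lambda>i. \<sigma> (js i))" "\<And>\<sigma> r. r \<noteq> u \<Longrightarrow> r \<noteq> t \<Longrightarrow> T \<sigma> r = \<sigma> r"
    by blast
  have 1: "prog s 1 (\<lambda>\<sigma>. \<sigma>(t := f y))"
    using assms by (intro prog_assign_affine affine_functional_intros)
  have 2: "prog s e (\<lambda>\<sigma>. \<sigma>(t := \<sigma> t - L * (\<Sum>i<e. \<bar>\<sigma> (js i) - y i\<bar>)))"
    using assms by (intro prog_subtract_dist) auto
  have 3: "prog s 1 (\<lambda>\<sigma>. \<sigma>(u := max (\<sigma> u) (\<sigma> t)))"
    using assms by (intro prog_assign_max)
  define P where "P \<sigma> = (let \<sigma>1 = \<sigma>(t := f y); \<sigma>2 = \<sigma>1(t := \<sigma>1 t - L * (\<Sum>i<e. \<bar>\<sigma>1 (js i) - y i\<bar>))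
    in \<sigma>2(u := max (\<sigma>2 u) (\<sigma>2 t)))" for \<sigma>
  have "prog s (1 + e + 1 + length Y * (e + 2)) (\<lambda>\<sigma>. T (P \<sigma>))"
    using prog_compose[OF T(1) prog_compose[OF 3 prog_compose[OF 2 1]]]
    by (simp only: P_def Let_def)
  moreover have P: "P \<sigma> u = max (\<sigma> u) (f y - L * (\<Sum>i<e. \<bar>\<sigma> (js i) - y i\<bar>))"
    "r \<noteq> u \<Longrightarrow> r \<noteq> t \<Longrightarrow> P \<sigma> r = \<sigma> r" for \<sigma> r
    using assms by (auto simp: P_def Let_def)
  moreover have "envelope L e f Y r (\<lambda>i. P \<sigma> (js i)) = envelope L e f Y r (\<lambda>i. \<sigma> (js i))" for \<sigma> r
  proof -
    have "(\<Sum>i<e. \<bar>P \<sigma> (js i) - z i\<bar>) = (\<Sum>i<e. \<bar>\<sigma> (js i) - z i\<bar>)" for z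
      using assms by (intro sum.cong) (auto simp: P(2))
    then show ?thesis by (simp add: envelope_def)
  qed
  moreover have "1 + e + 1 + length Y * (e + 2) = length (y # Y) * (e + 2)" by simp
  ultimately show ?case
    by (intro exI[of _ "\<lambda>\<sigma>. T (P \<sigma>)"] conjI allI impI) (simp_all only: T P envelope_simps not_False_eq_True simp_thms)
qed

section \<open>Programs for the coordinates of a layer\<close>

text \<open>The program must exist for every choice of three registers outside the inputs: u
  receives the result, v and t are scratch. Several coordinates can thus be scheduled one after
  another with different result registers and common scratch. The Lipschitz bound concerns all
  states, not only those in the cube.\<close>

definition scalar_prog :: "nat \<Rightarrow> real \<Rightarrow> real \<Rightarrow> ((nat \<Rightarrow> real) \<Rightarrow> real) \<Rightarrow> bool" where
  "scalar_prog m N \<Lambda> h \<longleftrightarrow>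
    (\<forall>s u v t. {u, v, t} \<subseteq> {m..<s} \<and> distinct [u, v, t] \<longrightarrow>
      (\<exists>T M. prog s M T \<and> real M \<le> N \<and>
        (\<forall>\<sigma>. T \<sigma> u = h \<sigma> \<and> (\<forall>r. r \<notin> {u, v, t} \<longrightarrow> T \<sigma> r = \<sigma> r)))) \<and>
    (\<forall>\<sigma> \<tau>. \<bar>h \<sigma> - h \<tau>\<bar> \<le> \<Lambda> * (\<Sum>i<m. \<bar>\<sigma> i - \<tau> i\<bar>))"

lemma scalar_progI:
  assumes "\<And>s u v t. m \<le> u \<Longrightarrow> u < s \<Longrightarrow> m \<le> v \<Longrightarrow> v < s \<Longrightarrow> m \<le> t \<Longrightarrow> t < s \<Longrightarrow> u \<noteq> v \<Longrightarrow> u \<noteq> t \<Longrightarrow> v \<noteq> t \<Longrightarrow>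
      \<exists>T M. prog s M T \<and> real M \<le> N \<and> (\<forall>\<sigma>. T \<sigma> u = h \<sigma>) \<and>
        (\<forall>\<sigma> r. r \<notin> {u, v, t} \<longrightarrow> T \<sigma> r = \<sigma> r)"
    and "\<And>\<sigma> \<tau>. \<bar>h \<sigma> - h \<tau>\<bar> \<le> \<Lambda> * (\<Sum>i<m. \<bar>\<sigma> i - \<tau> i\<bar>)"
  shows "scalar_prog m N \<Lambda> h"
  unfolding scalar_prog_def
proof (intro conjI allI impI)
  fix s u v t :: nat assume "{u, v, t} \<subseteq> {m..<s} \<and> distinct [u, v, t]"
  then obtain T M where "prog s M T" "real M \<le> N" "\<And>\<sigma>. T \<sigma> u = h \<sigma>"
    "\<And>\<sigma> r. r \<notin> {u, v, t} \<Longrightarrow> T \<sigma> r = \<sigma> r"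
    using assms(1)[of u s v t] by auto
  then show "\<exists>T M. prog s M T \<and> real M \<le> N \<and>
        (\<forall>\<sigma>. T \<sigma> u = h \<sigma> \<and> (\<forall>r. r \<notin> {u, v, t} \<longrightarrow> T \<sigma> r = \<sigma> r))"
    by (intro exI[of _ T] exI[of _ M]) simp
qed (fact assms(2))

lemma scalar_progD:
  assumes "scalar_prog m N \<Lambda> h" "{u, v, t} \<subseteq> {m..<s}" "distinct [u, v, t]"
  obtains T M where "prog s M T" "real M \<le> N" "\<And>\<sigma>. T \<sigma> u = h \<sigma>"
    "\<And>\<sigma> r. r \<notin> {u, v, t} \<Longrightarrow> T \<sigma> r = \<sigma> r"
proof -
  have "\<exists>T M. prog s M T \<and> real M \<le> N \<and>
        (\<forall>\<sigma>. T \<sigma> u = h \<sigma> \<and> (\<forall>r. r \<notin> {u, v, t} \<longrightarrow> T \<sigma> r = \<sigma> r))"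
    using assms(1)[unfolded scalar_prog_def, THEN conjunct1, rule_format, OF conjI[OF assms(2,3)]] .
  then obtain T M where T: "prog s M T" "real M \<le> N"
    "\<forall>\<sigma>. T \<sigma> u = h \<sigma> \<and> (\<forall>r. r \<notin> {u, v, t} \<longrightarrow> T \<sigma> r = \<sigma> r)"
    by blast
  show thesis by (rule that[OF T(1,2)]) (use T(3) in auto)
qed

lemma scalar_prog_lipschitz:
  "scalar_prog m N \<Lambda> h \<Longrightarrow> \<bar>h \<sigma> - h \<tau>\<bar> \<le> \<Lambda> * (\<Sum>i<m. \<bar>\<sigma> i - \<tau> i\<bar>)"
  unfolding scalar_prog_def by blast

text \<open>For states that agree on the inputs the Lipschitz bound is 0. Hence a coordinate may be
  computed after other registers have been overwritten.\<close>

lemma scalar_prog_cong: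
  assumes "scalar_prog m N \<Lambda> h" "\<And>i. i < m \<Longrightarrow> \<sigma> i = \<tau> i"
  shows "h \<sigma> = h \<tau>"
proof -
  have "(\<Sum>i<m. \<bar>\<sigma> i - \<tau> i\<bar>) = 0" using assms by simp
  then show ?thesis using scalar_prog_lipschitz[OF assms(1), of \<sigma> \<tau>] by simp
qed

lemma scalar_prog_mono:
  assumes "scalar_prog m N \<Lambda> h" "N \<le> N'"
  shows "scalar_prog m N' \<Lambda> h"
proof (rule scalar_progI)
  fix s u v t :: nat
  assume "m \<le> u" "u < s" "m \<le> v" "v < s" "m \<le> t" "t < s" "u \<noteq> v" "u \<noteq> t" "v \<noteq> t"
  then have uvt: "{u, v, t} \<subseteq> {m..<s}" "distinct [u, v, t]" by auto
  obtain T M where "prog s M T" "real M \<le> N" "\<And>\<sigma>. T \<sigma> u = h \<sigma>"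
    "\<And>\<sigma> r. r \<notin> {u, v, t} \<Longrightarrow> T \<sigma> r = \<sigma> r"
    by (rule scalar_progD[OF assms(1) uvt], rule that)
  then show "\<exists>T M. prog s M T \<and> real M \<le> N' \<and> (\<forall>\<sigma>. T \<sigma> u = h \<sigma>) \<and>
        (\<forall>\<sigma> r. r \<notin> {u, v, t} \<longrightarrow> T \<sigma> r = \<sigma> r)"
    using assms(2) by (intro exI[of _ T] exI[of _ M]) auto
qed (rule scalar_prog_lipschitz[OF assms(1)])

lemma scalar_prog_lipschitz_block:
  fixes f :: "(nat \<Rightarrow> real) \<Rightarrow> real"
  assumes "a < b" "0 < \<delta>" "\<delta> \<le> 1" "b - a \<le> 2 * B" "1 \<le> B" "e \<le> q" "1 \<le> q" "lo + e \<le> m"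
    and lip: "\<And>v w. in_cube e a b v \<Longrightarrow> in_cube e a b w \<Longrightarrow> \<bar>f v - f w\<bar> \<le> B * (\<Sum>i<e. \<bar>v i - w i\<bar>)"
  shows "\<exists>h. scalar_prog m (grid_cost q B \<delta>) B h \<and>
    (\<forall>\<sigma>. in_cube m a b \<sigma> \<longrightarrow> \<bar>h \<sigma> - f (\<lambda>i. \<sigma> (lo + i))\<bar> \<le> \<delta>)"
proof -
  obtain Y r where Y: "real (length Y * (e + 2) + 1) \<le> grid_cost q B \<delta>"
    "\<And>v. in_cube e a b v \<Longrightarrow> \<bar>envelope B e f Y r v - f v\<bar> \<le> \<delta>"
    using lipschitz_envelope_cost[of a b B \<delta> B e q f] assms lip by auto
  define h where "h \<sigma> = envelope B e f Y r (\<lambda>i. \<sigma> (lo + i))" for \<sigma>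
  have "scalar_prog m (grid_cost q B \<delta>) B h"
  proof (rule scalar_progI)
    fix s u v t :: nat
    assume uvt: "m \<le> u" "u < s" "m \<le> v" "v < s" "m \<le> t" "t < s" "u \<noteq> v" "u \<noteq> t" "v \<noteq> t"
    have "\<exists>T. prog s (length Y * (e + 2)) T \<and> (\<forall>\<sigma>. T \<sigma> u = envelope B e f Y (\<sigma> u) (\<lambda>i. \<sigma> (lo + i)) \<and>
        (\<forall>r. r \<noteq> u \<longrightarrow> r \<noteq> t \<longrightarrow> T \<sigma> r = \<sigma> r))"
      using uvt assms by (intro prog_envelope) auto
    then obtain T where T: "prog s (length Y * (e + 2)) T"
      "\<And>\<sigma>. T \<sigma> u = envelope B e f Y (\<sigma> u) (\<lambda>i. \<sigma> (lo + i))" "\<And>\<sigma> r. r \<noteq> u \<Longrightarrow> r \<noteq> t \<Longrightarrow> T \<sigma> r = \<sigma> r"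
      by blast
    \<comment> \<open>The additional step loads the start value r into u; it is the summand 1 in
      \<open>lipschitz_envelope_cost\<close>.\<close>
    have "prog s (1 + length Y * (e + 2)) (\<lambda>\<sigma>. T (\<sigma>(u := r)))"
      using uvt by (intro prog_compose[OF T(1)] prog_assign_affine affine_functional_intros)
    moreover have "(\<lambda>i. (\<sigma>(u := r)) (lo + i)) i = \<sigma> (lo + i)" if "i < e" for \<sigma> i
      using that uvt assms by auto
    then have "envelope B e f Y r (\<lambda>i. (\<sigma>(u := r)) (lo + i)) = h \<sigma>" for \<sigma>
      by (simp add: h_def envelope_def)
    ultimately show "\<exists>T M. prog s M T \<and> real M \<le> grid_cost q B \<delta> \<and> (\<forall>\<sigma>. T \<sigma> u = h \<sigma>) \<and>
        (\<forall>\<sigma> r. r \<notin> {u, v, t} \<longrightarrow> T \<sigma> r = \<sigma> r)"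
      using Y(1) by (intro exI[of _ "\<lambda>\<sigma>. T (\<sigma>(u := r))"] exI[of _ "1 + length Y * (e + 2)"])
        (auto simp: T)
  next
    fix \<sigma> \<tau> :: "nat \<Rightarrow> real"
    have "(\<Sum>i<e. \<bar>\<sigma> (lo + i) - \<tau> (lo + i)\<bar>) = (\<Sum>i\<in>(\<lambda>i. lo + i) ` {..<e}. \<bar>\<sigma> i - \<tau> i\<bar>)"
      by (subst sum.reindex) (auto simp: inj_on_def)
    also have "\<dots> \<le> (\<Sum>i<m. \<bar>\<sigma> i - \<tau> i\<bar>)"
      using assms by (intro sum_mono2) auto
    finally have "B * (\<Sum>i<e. \<bar>\<sigma> (lo + i) - \<tau> (lo + i)\<bar>) \<le> B * (\<Sum>i<m. \<bar>\<sigma> i - \<tau> i\<bar>)"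
      using assms by (intro mult_left_mono) auto
    then show "\<bar>h \<sigma> - h \<tau>\<bar> \<le> B * (\<Sum>i<m. \<bar>\<sigma> i - \<tau> i\<bar>)"
      unfolding h_def using assms by (intro order_trans[OF envelope_lipschitz]) auto
  qed
  moreover have "\<bar>h \<sigma> - f (\<lambda>i. \<sigma> (lo + i))\<bar> \<le> \<delta>" if "in_cube m a b \<sigma>" for \<sigma>
    unfolding h_def using that assms by (intro Y(2)) (auto simp: in_cube_def)
  ultimately show ?thesis by blast
qed

section \<open>Monotonicity of the grid cost, and folds of a binary operation\<close>

lemma grid_cost_ge_1:
  assumes "1 \<le> B" "0 < \<delta>" "\<delta> \<le> 1" "1 \<le> q"
  shows "1 \<le> grid_cost q B \<delta>"
proof -
  have "1 * 1 \<le> (7 * real q) * B ^ 2" using assms by (intro mult_mono) auto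
  then have "1 \<le> 7 * real q * B ^ 2 / \<delta>" using assms by simp
  then have "1 * 1 \<le> (real q + 3) * (7 * real q * B ^ 2 / \<delta>) ^ q"
    by (intro mult_mono one_le_power) auto
  then show ?thesis by (simp add: grid_cost_def)
qed

lemma grid_cost_antimono:
  assumes "1 \<le> B" "0 < \<delta>" "\<delta> \<le> \<eta>"
  shows "grid_cost q B \<eta> \<le> grid_cost q B \<delta>"
  unfolding grid_cost_def using assms
  by (intro mult_left_mono power_mono divide_left_mono) (auto intro!: mult_nonneg_nonneg divide_nonneg_pos)

text \<open>
  In a program for a product or maximum over a segment, \<open>z\<close> is the neutral element, \<open>u\<close> the
  accumulator, \<open>v\<close> the result of one approximate binary operation and \<open>t\<close> its scratch register.
\<close>

lemma prog_fold:
  fixes \<mu> :: "real \<Rightarrow> real \<Rightarrow> real"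
  assumes \<mu>: "\<And>x y. \<mu> x y = envelope L 2 f Y r (\<lambda>i. if i = 0 then x else y)"
    and "u < s" "v < s" "t < s" "distinct [u, v, t]" "\<forall>j\<in>set js. j < s \<and> j \<notin> {u, v, t}"
  shows "\<exists>T. prog s (1 + length js * (length Y * 4 + 2)) T \<and>
    (\<forall>\<sigma>. T \<sigma> u = fold (\<lambda>j x. \<mu> x (\<sigma> j)) js z) \<and> (\<forall>\<sigma> r. r \<notin> {u, v, t} \<longrightarrow> T \<sigma> r = \<sigma> r)"
  using assms(6)
proof (induction js rule: rev_induct)
  case Nil
  have "prog s 1 (\<lambda>\<sigma>. \<sigma>(u := z))"
    using assms by (intro prog_assign_affine affine_functional_intros)
  then show ?case by (intro exI[of _ "\<lambda>\<sigma>. \<sigma>(u := z)"]) (simp del: fun_upd_apply, simp)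
next
  case (snoc j js)
  then obtain T where T: "prog s (1 + length js * (length Y * 4 + 2)) T"
    "\<And>\<sigma>. T \<sigma> u = fold (\<lambda>j x. \<mu> x (\<sigma> j)) js z" "\<And>\<sigma> r. r \<notin> {u, v, t} \<Longrightarrow> T \<sigma> r = \<sigma> r"
    by auto
  \<comment> \<open>The envelope reads the accumulator u once per grid point, so it must not write
    there. It writes to v, and the result is copied back to u. Loading r and this copy are the two
    steps beyond the 4 per grid point.\<close>
  define ji where "ji i = (if i = 0 then u else j)" for i :: nat
  have "\<exists>E. prog s (length Y * (2 + 2)) E \<and> (\<forall>\<sigma>. E \<sigma> v = envelope L 2 f Y (\<sigma> v) (\<lambda>i. \<sigma> (ji i)) \<and>
        (\<forall>r. r \<noteq> v \<longrightarrow> r \<noteq> t \<longrightarrow> E \<sigma> r = \<sigma> r))"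
    using assms snoc.prems by (intro prog_envelope) (auto simp: ji_def)
  then obtain E where E: "prog s (length Y * (2 + 2)) E"
      "\<And>\<sigma>. E \<sigma> v = envelope L 2 f Y (\<sigma> v) (\<lambda>i. \<sigma> (ji i))" "\<And>\<sigma> r. r \<noteq> v \<Longrightarrow> r \<noteq> t \<Longrightarrow> E \<sigma> r = \<sigma> r"
    by blast
  define P where "P \<sigma> = (E (\<sigma>(v := r)))(u := E (\<sigma>(v := r)) v)" for \<sigma>
  have 1: "prog s 1 (\<lambda>\<sigma>. \<sigma>(v := r))"
    using assms by (intro prog_assign_affine affine_functional_intros)
  have 2: "prog s 1 (\<lambda>\<sigma>. \<sigma>(u := \<sigma> v))"
    using assms by (intro prog_assign_affine affine_functional_intros)
  have "prog s (1 + length js * (length Y * 4 + 2) + (1 + length Y * (2 + 2) + 1)) (\<lambda>\<sigma>. P (T \<sigma>))"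
    unfolding P_def using prog_compose[OF prog_compose[OF 2 prog_compose[OF E(1) 1]] T(1)] .
  moreover have "(1 + length js * (length Y * 4 + 2) + (1 + length Y * (2 + 2) + 1))
      = 1 + length (js @ [j]) * (length Y * 4 + 2)" by simp
  ultimately have PT: "prog s (1 + length (js @ [j]) * (length Y * 4 + 2)) (\<lambda>\<sigma>. P (T \<sigma>))"
    by (simp only:)
  moreover have "P \<sigma> u = \<mu> (\<sigma> u) (\<sigma> j)" for \<sigma>
  proof -
    have "(\<lambda>i. (\<sigma>(v := r)) (ji i)) = (\<lambda>i. if i = 0 then \<sigma> u else \<sigma> j)"
      using assms snoc.prems by (auto simp: ji_def)
    then show ?thesis by (simp add: P_def E(2) \<mu>)
  qed
  moreover have "P \<sigma> i = \<sigma> i" if "i \<notin> {u, v, t}" for \<sigma> i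
    using that by (simp add: P_def E(3))
  ultimately show ?case
    using T(2,3) snoc.prems by (intro exI[of _ "\<lambda>\<sigma>. P (T \<sigma>)"] conjI[OF PT]) auto
qed

text \<open>With constant 1 in the accumulator a deviation is passed on without amplification. A
  larger constant would compound geometrically along the list in this argument.\<close>

lemma fold_lipschitz:
  fixes \<mu> :: "real \<Rightarrow> real \<Rightarrow> real"
  assumes "\<And>x y x' y'. \<bar>\<mu> x y - \<mu> x' y'\<bar> \<le> \<bar>x - x'\<bar> + \<bar>y - y'\<bar>"
  shows "\<bar>fold (\<lambda>j x. \<mu> x (\<sigma> j)) js z - fold (\<lambda>j x. \<mu> x (\<tau> j)) js z\<bar> \<le> (\<Sum>j\<leftarrow>js. \<bar>\<sigma> j - \<tau> j\<bar>)"
proof (induction js rule: rev_induct)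
  case (snoc j js)
  show ?case
    using snoc assms[of "fold (\<lambda>j x. \<mu> x (\<sigma> j)) js z" "\<sigma> j" "fold (\<lambda>j x. \<mu> x (\<tau> j)) js z" "\<tau> j"]
    by simp
qed simp

text \<open>Only the exact accumulator is kept in I, where \<phi> is approximated. The approximate
  one may leave I, and it is compared with the exact one through the global Lipschitz bound of
  \<mu>.\<close>

lemma fold_error:
  fixes \<mu> \<phi> :: "real \<Rightarrow> real \<Rightarrow> real"
  assumes "\<And>x y x' y'. \<bar>\<mu> x y - \<mu> x' y'\<bar> \<le> \<bar>x - x'\<bar> + \<bar>y - y'\<bar>"
    and "\<And>x y. x \<in> I \<Longrightarrow> y \<in> I \<Longrightarrow> \<phi> x y \<in> I \<and> \<bar>\<mu> x y - \<phi> x y\<bar> \<le> \<eta>"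
    and "z \<in> I" "\<forall>j\<in>set js. \<sigma> j \<in> I"
  shows "fold (\<lambda>j x. \<phi> x (\<sigma> j)) js z \<in> I \<and>
    \<bar>fold (\<lambda>j x. \<mu> x (\<sigma> j)) js z - fold (\<lambda>j x. \<phi> x (\<sigma> j)) js z\<bar> \<le> real (length js) * \<eta>"
  using assms(4)
proof (induction js rule: rev_induct)
  case Nil
  then show ?case using assms(3) by simp
next
  case (snoc j js)
  let ?x = "fold (\<lambda>j x. \<mu> x (\<sigma> j)) js z" and ?y = "fold (\<lambda>j x. \<phi> x (\<sigma> j)) js z"
  have IH: "?y \<in> I" "\<bar>?x - ?y\<bar> \<le> real (length js) * \<eta>" using snoc by auto
  have "\<phi> ?y (\<sigma> j) \<in> I" "\<bar>\<mu> ?y (\<sigma> j) - \<phi> ?y (\<sigma> j)\<bar> \<le> \<eta>"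
    using assms(2) IH snoc.prems by auto
  moreover have "\<bar>\<mu> ?x (\<sigma> j) - \<mu> ?y (\<sigma> j)\<bar> \<le> real (length js) * \<eta>"
    using assms(1)[of ?x "\<sigma> j" ?y "\<sigma> j"] IH by simp
  ultimately show ?case by (simp add: algebra_simps)
qed

text \<open>The operation \<phi> is replaced by its envelope in two variables with accuracy \<delta>
  / B. At most m \<le> B operations occur, so their errors add up to at most \<delta>.\<close>

lemma scalar_prog_fold:
  fixes \<phi> :: "real \<Rightarrow> real \<Rightarrow> real"
  assumes "0 < \<delta>" "\<delta> \<le> 1" "1 \<le> A" "A \<le> B" "2 \<le> q" "hi \<le> m" "real m \<le> B" "z \<in> {-A..A}"
    and \<phi>: "\<And>x y. x \<in> {-A..A} \<Longrightarrow> y \<in> {-A..A} \<Longrightarrow> \<phi> x y \<in> {-A..A}"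
    and lip: "\<And>x y x' y'. x \<in> {-A..A} \<Longrightarrow> y \<in> {-A..A} \<Longrightarrow> x' \<in> {-A..A} \<Longrightarrow> y' \<in> {-A..A} \<Longrightarrow>
      \<bar>\<phi> x y - \<phi> x' y'\<bar> \<le> \<bar>x - x'\<bar> + \<bar>y - y'\<bar>"
  shows "\<exists>h. scalar_prog m (4 * B * grid_cost q B (\<delta> / B)) B h \<and>
    (\<forall>\<sigma>. in_cube m (-A) A \<sigma> \<longrightarrow> \<bar>h \<sigma> - fold (\<lambda>j x. \<phi> x (\<sigma> j)) [lo..<hi] z\<bar> \<le> \<delta>)"
proof -
  define G where "G = grid_cost q B (\<delta> / B)"
  have \<delta>B: "0 < \<delta> / B" "\<delta> / B \<le> 1" using assms by auto
  have "1 \<le> G" unfolding G_def using assms \<delta>B by (intro grid_cost_ge_1) auto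
  have S2: "(\<Sum>i<(2::nat). g i) = g 0 + g 1" for g :: "nat \<Rightarrow> real"
    by (simp add: numeral_2_eq_2)
  define f where "f v = \<phi> (v 0) (v 1)" for v :: "nat \<Rightarrow> real"
  have "\<bar>f v - f w\<bar> \<le> 1 * (\<Sum>i<2. \<bar>v i - w i\<bar>)" if "in_cube 2 (-A) A v" "in_cube 2 (-A) A w" for v w
    using that lip[of "v 0" "v 1" "w 0" "w 1"] by (auto simp: in_cube_def f_def S2)
  then obtain Y r where Y: "real (length Y * (2 + 2) + 1) \<le> G"
    "\<And>v. in_cube 2 (-A) A v \<Longrightarrow> \<bar>envelope 1 2 f Y r v - f v\<bar> \<le> \<delta> / B"
    using lipschitz_envelope_cost[of "-A" A 1 "\<delta> / B" B 2 q f] assms \<delta>B unfolding G_def by auto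
  define \<mu> where "\<mu> x y = envelope 1 2 f Y r (\<lambda>i. if i = 0 then x else y)" for x y
  have \<mu>_lip: "\<bar>\<mu> x y - \<mu> x' y'\<bar> \<le> \<bar>x - x'\<bar> + \<bar>y - y'\<bar>" for x y x' y'
    unfolding \<mu>_def by (rule order_trans[OF envelope_lipschitz]) (auto simp: S2)
  have \<mu>_\<phi>: "\<bar>\<mu> x y - \<phi> x y\<bar> \<le> \<delta> / B" if "x \<in> {-A..A}" "y \<in> {-A..A}" for x y
    using that Y(2)[of "\<lambda>i. if i = 0 then x else y"] by (auto simp: \<mu>_def f_def in_cube_def)
  define h where "h \<sigma> = fold (\<lambda>j x. \<mu> x (\<sigma> j)) [lo..<hi] z" for \<sigma>
  have "scalar_prog m (4 * B * G) B h"
  proof (rule scalar_progI)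
    fix s u v t :: nat
    assume uvt: "m \<le> u" "u < s" "m \<le> v" "v < s" "m \<le> t" "t < s" "u \<noteq> v" "u \<noteq> t" "v \<noteq> t"
    obtain T where T: "prog s (1 + (hi - lo) * (length Y * 4 + 2)) T" "\<And>\<sigma>. T \<sigma> u = h \<sigma>"
      "\<And>\<sigma> r. r \<notin> {u, v, t} \<Longrightarrow> T \<sigma> r = \<sigma> r"
      using prog_fold[of \<mu> 1 f Y r u s v t "[lo..<hi]" z] uvt assms unfolding h_def \<mu>_def by auto
    \<comment> \<open>One operation takes 4 |Y| + 2 \<le> G + 1 \<le> 2 G steps, and the initial
      step is absorbed by B G \<ge> 1.\<close>
    have "real (hi - lo) \<le> B" using assms by linarith
    then have "real (hi - lo) * real (length Y * 4 + 2) \<le> B * (2 * G)"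
      using Y(1) assms \<open>1 \<le> G\<close> by (intro mult_mono) auto
    moreover have "1 * 1 \<le> B * G" using assms \<open>1 \<le> G\<close> by (intro mult_mono) auto
    ultimately have "1 + real (hi - lo) * real (length Y * 4 + 2) \<le> 4 * B * G"
      by linarith
    then have "real (1 + (hi - lo) * (length Y * 4 + 2)) \<le> 4 * B * G"
      unfolding of_nat_add of_nat_mult by simp
    then show "\<exists>T M. prog s M T \<and> real M \<le> 4 * B * G \<and> (\<forall>\<sigma>. T \<sigma> u = h \<sigma>) \<and>
        (\<forall>\<sigma> r. r \<notin> {u, v, t} \<longrightarrow> T \<sigma> r = \<sigma> r)"
      using T by blast
  next
    fix \<sigma> \<tau> :: "nat \<Rightarrow> real"
    have "\<bar>h \<sigma> - h \<tau>\<bar> \<le> (\<Sum>j\<leftarrow>[lo..<hi]. \<bar>\<sigma> j - \<tau> j\<bar>)"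
      unfolding h_def using \<mu>_lip by (rule fold_lipschitz)
    also have "\<dots> = (\<Sum>j\<in>{lo..<hi}. \<bar>\<sigma> j - \<tau> j\<bar>)"
      by (subst sum_list_distinct_conv_sum_set) auto
    also have "\<dots> \<le> (\<Sum>j<m. \<bar>\<sigma> j - \<tau> j\<bar>)"
      using assms by (intro sum_mono2) auto
    also have "\<dots> \<le> B * (\<Sum>j<m. \<bar>\<sigma> j - \<tau> j\<bar>)"
      using mult_right_mono[of 1 B "\<Sum>j<m. \<bar>\<sigma> j - \<tau> j\<bar>"] assms by (simp add: sum_nonneg)
    finally show "\<bar>h \<sigma> - h \<tau>\<bar> \<le> B * (\<Sum>j<m. \<bar>\<sigma> j - \<tau> j\<bar>)" .
  qed
  moreover have "\<bar>h \<sigma> - fold (\<lambda>j x. \<phi> x (\<sigma> j)) [lo..<hi] z\<bar> \<le> \<delta>" if "in_cube m (-A) A \<sigma>" for \<sigma>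
  proof -
    have "\<bar>h \<sigma> - fold (\<lambda>j x. \<phi> x (\<sigma> j)) [lo..<hi] z\<bar> \<le> real (length [lo..<hi]) * (\<delta> / B)"
      unfolding h_def using that \<mu>_lip \<phi> \<mu>_\<phi> assms
      by (intro conjunct2[OF fold_error[where I = "{-A..A}"]]) (auto simp: in_cube_def)
    also have "\<dots> \<le> B * (\<delta> / B)"
      using assms by (intro mult_right_mono) auto
    finally show ?thesis using assms by simp
  qed
  ultimately show ?thesis unfolding G_def by blast
qed

text \<open>Registers from m to m + n - 1 hold the results, and the last two are scratch shared by
  all coordinates. A later program changes neither the inputs nor the earlier results.\<close>

lemma scalar_progs_sequence:
  assumes "\<And>i. i < n \<Longrightarrow> scalar_prog m N \<Lambda> (h i)"
  shows "k \<le> n \<Longrightarrow> \<exists>T M. prog (m + n + 2) M T \<and> real M \<le> real k * N \<and>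
    (\<forall>\<sigma>. (\<forall>i<k. T \<sigma> (m + i) = h i \<sigma>) \<and> (\<forall>r<m. T \<sigma> r = \<sigma> r))"
proof (induction k)
  case 0
  show ?case using prog_skip by (intro exI[of _ "\<lambda>\<sigma>. \<sigma>"] exI[of _ 0]) auto
next
  case (Suc k)
  then obtain T M where T: "prog (m + n + 2) M T" "real M \<le> real k * N"
    "\<And>\<sigma> i. i < k \<Longrightarrow> T \<sigma> (m + i) = h i \<sigma>" "\<And>\<sigma> r. r < m \<Longrightarrow> T \<sigma> r = \<sigma> r"
    by auto
  have h: "scalar_prog m N \<Lambda> (h k)" using assms Suc by simp
  obtain T' M' where T': "prog (m + n + 2) M' T'" "real M' \<le> N" "\<And>\<sigma>. T' \<sigma> (m + k) = h k \<sigma>"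
    "\<And>\<sigma> r. r \<notin> {m + k, m + n, m + n + 1} \<Longrightarrow> T' \<sigma> r = \<sigma> r"
    by (rule scalar_progD[OF h, of "m + k" "m + n" "m + n + 1" "m + n + 2"]) (use Suc in auto)
  have "h k (T \<sigma>) = h k \<sigma>" for \<sigma>
    using T(4) by (intro scalar_prog_cong[OF h])
  then have "(\<forall>i<Suc k. T' (T \<sigma>) (m + i) = h i \<sigma>) \<and> (\<forall>r<m. T' (T \<sigma>) r = \<sigma> r)" for \<sigma>
    using T T' Suc by (auto simp: less_Suc_eq)
  moreover have "real (M + M') \<le> real (Suc k) * N"
    using T(2) T'(2) by (simp add: algebra_simps)
  ultimately show ?case
    using prog_compose[OF T'(1) T(1)] by blast
qed

lemma net_fun_scalar_progs:
  assumes "\<And>i. i < n \<Longrightarrow> scalar_prog m N \<Lambda> (h i)" "1 \<le> m" "1 \<le> n"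
  shows "\<exists>M. real M \<le> 2 * real n * N + 2 \<and>
    net_fun (3 * (m + n + 2)) m n M (\<lambda>x. vec n (\<lambda>i. h i (vec_state m x)))"
proof -
  obtain T M where T: "prog (m + n + 2) M T" "real M \<le> real n * N"
    "\<And>\<sigma> i. i < n \<Longrightarrow> T \<sigma> (m + i) = h i \<sigma>"
    using scalar_progs_sequence[of n m N \<Lambda> h n] assms(1) by auto
  have "net_fun (3 * (m + n + 2)) m n (2 * M + 2) (\<lambda>x. vec n (\<lambda>i. T (vec_state m x) (m + i)))"
    using net_fun_prog_outputs[OF T(1)] assms by simp
  moreover have "vec n (\<lambda>i. T (vec_state m x) (m + i)) = vec n (\<lambda>i. h i (vec_state m x))" for x
    using T by (intro eq_vecI) auto
  ultimately show ?thesis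
    using T(2) by (intro exI[of _ "2 * M + 2"]) simp
qed

section \<open>Approximating a layer\<close>

definition dist1 :: "nat \<Rightarrow> rvec \<Rightarrow> rvec \<Rightarrow> real" where
  "dist1 n x y = (\<Sum>i<n. \<bar>x $ i - y $ i\<bar>)"

lemma dist1_nonneg: "0 \<le> dist1 n x y"
  by (simp add: dist1_def sum_nonneg)

lemma dist1_triangle: "dist1 n x z \<le> dist1 n x y + dist1 n y z"
  unfolding dist1_def sum.distrib[symmetric] by (intro sum_mono) linarith

text \<open>With z_i \<le> S for the sum S, one has z_i^r = z_i z_i^(r-1) \<le> z_i S^(r-1), and
  summation gives S^r. The same inequality weakens the Lipschitz hypotheses and strengthens the
  final error bound.\<close>

lemma lp_norm_le_dist1:
  assumes "1 \<le> p" "1 \<le> n" "x \<in> carrier_vec n" "y \<in> carrier_vec n"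
  shows "lp_norm p (x - y) \<le> dist1 n x y"
proof (cases "p = \<infinity>")
  case True
  have "Max ((\<lambda>i. \<bar>(x - y) $ i\<bar>) ` {..<n}) \<le> dist1 n x y"
  proof (rule Max.boundedI)
    fix z assume "z \<in> (\<lambda>i. \<bar>(x - y) $ i\<bar>) ` {..<n}"
    then obtain i where i: "i < n" "z = \<bar>x $ i - y $ i\<bar>" using assms by auto
    then show "z \<le> dist1 n x y"
      unfolding dist1_def using member_le_sum[of i "{..<n}" "\<lambda>i. \<bar>x $ i - y $ i\<bar>"] by simp
  qed (use assms in \<open>auto simp: lessThan_empty_iff\<close>)
  then show ?thesis using True assms by (simp add: lp_norm_def)
next
  case False
  define r where "r = real_of_ereal p"
  have r: "1 \<le> r" using assms(1) False by (cases p) (auto simp: r_def)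
  define S where "S = dist1 n x y"
  define z where "z i = \<bar>x $ i - y $ i\<bar>" for i
  have S: "S = (\<Sum>i<n. z i)" by (simp add: S_def dist1_def z_def)
  have "0 \<le> S" by (simp add: S_def dist1_nonneg)
  have lp: "lp_norm p (x - y) = (\<Sum>i<n. z i powr r) powr (1 / r)"
    using False assms by (simp add: lp_norm_def r_def z_def)
  have le: "z i powr r \<le> z i * S powr (r - 1)" if "i < n" for i
  proof (cases "z i = 0")
    case False
    then have "0 < z i" by (simp add: z_def)
    have "z i \<le> S" unfolding S using that by (intro member_le_sum) (auto simp: z_def)
    then have "z i powr (r - 1) \<le> S powr (r - 1)" using r \<open>0 < z i\<close> by (intro powr_mono2) auto
    then have "z i * z i powr (r - 1) \<le> z i * S powr (r - 1)" using \<open>0 < z i\<close> by simp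
    moreover have "z i powr r = z i * z i powr (r - 1)"
      using \<open>0 < z i\<close> powr_add[of "z i" 1 "r - 1"] by simp
    ultimately show ?thesis by simp
  qed simp
  have "(\<Sum>i<n. z i powr r) \<le> (\<Sum>i<n. z i * S powr (r - 1))"
    using le by (intro sum_mono) auto
  also have "\<dots> = S * S powr (r - 1)" by (simp add: S sum_distrib_right)
  also have "\<dots> = S powr r"
  proof (cases "S = 0")
    case False
    then show ?thesis using \<open>0 \<le> S\<close> powr_add[of S 1 "r - 1"] by simp
  qed simp
  finally have "(\<Sum>i<n. z i powr r) powr (1 / r) \<le> (S powr r) powr (1 / r)"
    using r by (intro powr_mono2) (auto intro: sum_nonneg)
  also have "\<dots> = S" using r \<open>0 \<le> S\<close> by (simp add: powr_powr)
  finally show ?thesis by (simp add: lp S_def)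
qed

text \<open>A common interface for the coordinates of all five classes. The form of the cost is that
  of a fold, with accuracy \<eta> / B per operation; a Lipschitz block is cheaper and fits into
  it.\<close>

definition approximable :: "nat \<Rightarrow> nat \<Rightarrow> real \<Rightarrow> rvec set \<Rightarrow> (rvec \<Rightarrow> real) \<Rightarrow> bool" where
  "approximable q m B Q f \<longleftrightarrow> (\<forall>\<eta>. 0 < \<eta> \<and> \<eta> \<le> 1 \<longrightarrow>
    (\<exists>h. scalar_prog m (4 * B * grid_cost q B (\<eta> / B)) B h \<and>
      (\<forall>x\<in>Q. \<bar>h (vec_state m x) - f x\<bar> \<le> \<eta>)))"

text \<open>There are n \<le> B coordinates. Accuracy \<delta> / B for each gives \<delta> in the
  1-norm, and another factor B is spent inside \<open>approximable\<close>; this is the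
  \<open>B ^ 2\<close> in the grid cost. The Lipschitz constants B of the coordinates add up to at
  most \<open>B ^ 2\<close>.\<close>

lemma approximable_layer:
  assumes "1 \<le> B" "1 \<le> m" "1 \<le> n" "real m \<le> B" "real n \<le> B" "0 < \<delta>" "\<delta> \<le> 1" "1 \<le> q"
    and "\<And>i. i < n \<Longrightarrow> approximable q m B Q (\<lambda>x. g x $ i)"
  shows "\<exists>h M. real M \<le> 10 * B ^ 2 * grid_cost q B (\<delta> / B ^ 2) \<and> net_fun (3 * (m + n + 2)) m n M h \<and>
    (\<forall>x\<in>carrier_vec m. \<forall>y\<in>carrier_vec m. dist1 n (h x) (h y) \<le> B ^ 2 * dist1 m x y) \<and>
    (\<forall>x\<in>Q. dist1 n (h x) (g x) \<le> \<delta>)"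
proof -
  define G where "G = grid_cost q B (\<delta> / B ^ 2)"
  have "1 \<le> B ^ 2" using assms by simp
  then have "0 < B ^ 2" "\<delta> \<le> B ^ 2" using assms(7) by linarith+
  then have "\<delta> / B ^ 2 \<le> 1" "0 < \<delta> / B ^ 2" using assms(6) by auto
  then have "1 \<le> G" unfolding G_def using assms by (intro grid_cost_ge_1) auto
  have "\<forall>i\<in>{..<n}. \<exists>h. scalar_prog m (4 * B * G) B h \<and> (\<forall>x\<in>Q. \<bar>h (vec_state m x) - g x $ i\<bar> \<le> \<delta> / B)"
  proof
    fix i assume "i \<in> {..<n}"
    then have "approximable q m B Q (\<lambda>x. g x $ i)" using assms(9) by simp
    moreover have "0 < \<delta> / B" "\<delta> / B \<le> 1" using assms by auto
    ultimately obtain h where "scalar_prog m (4 * B * grid_cost q B (\<delta> / B / B)) B h"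
      "\<forall>x\<in>Q. \<bar>h (vec_state m x) - g x $ i\<bar> \<le> \<delta> / B"
      unfolding approximable_def by blast
    then show "\<exists>h. scalar_prog m (4 * B * G) B h \<and> (\<forall>x\<in>Q. \<bar>h (vec_state m x) - g x $ i\<bar> \<le> \<delta> / B)"
      by (auto simp: G_def power2_eq_square)
  qed
  then obtain h where h': "\<forall>i\<in>{..<n}. scalar_prog m (4 * B * G) B (h i) \<and>
      (\<forall>x\<in>Q. \<bar>h i (vec_state m x) - g x $ i\<bar> \<le> \<delta> / B)"
    unfolding bchoice_iff by blast
  then have h: "\<And>i. i < n \<Longrightarrow> scalar_prog m (4 * B * G) B (h i)"
    "\<And>i x. i < n \<Longrightarrow> x \<in> Q \<Longrightarrow> \<bar>h i (vec_state m x) - g x $ i\<bar> \<le> \<delta> / B"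
    by auto
  define H where "H x = vec n (\<lambda>i. h i (vec_state m x))" for x
  obtain M where M: "real M \<le> 2 * real n * (4 * B * G) + 2" "net_fun (3 * (m + n + 2)) m n M H"
    using net_fun_scalar_progs[of n m "4 * B * G" B h] h(1) assms unfolding H_def by blast
  have "2 * real n * (4 * B * G) \<le> 2 * B * (4 * B * G)"
    using assms \<open>1 \<le> G\<close> by (intro mult_right_mono mult_left_mono) auto
  moreover have "1 * 1 \<le> B ^ 2 * G" using \<open>1 \<le> B ^ 2\<close> \<open>1 \<le> G\<close> by (intro mult_mono) auto
  ultimately have "real M \<le> 10 * B ^ 2 * G"
    using M(1) by (simp add: power2_eq_square)
  moreover have "dist1 n (H x) (H y) \<le> B ^ 2 * dist1 m x y" for x y
  proof -
    have "dist1 n (H x) (H y) \<le> (\<Sum>i<n. B * dist1 m x y)"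
      unfolding dist1_def[of n]
    proof (rule sum_mono)
      fix i assume i: "i \<in> {..<n}"
      have "(\<Sum>j<m. \<bar>vec_state m x j - vec_state m y j\<bar>) = dist1 m x y"
        by (simp add: dist1_def vec_state_def)
      then show "\<bar>H x $ i - H y $ i\<bar> \<le> B * dist1 m x y"
        using scalar_prog_lipschitz[OF h(1), of i "vec_state m x" "vec_state m y"] i by (simp add: H_def)
    qed
    also have "\<dots> = real n * (B * dist1 m x y)" by simp
    also have "\<dots> \<le> B * (B * dist1 m x y)"
      using assms by (intro mult_right_mono) (auto simp: dist1_nonneg)
    finally show ?thesis by (simp add: power2_eq_square)
  qed
  moreover have "dist1 n (H x) (g x) \<le> \<delta>" if "x \<in> Q" for x
  proof -
    have "dist1 n (H x) (g x) \<le> (\<Sum>i<n. \<delta> / B)"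
      unfolding dist1_def by (rule sum_mono) (use h(2) that in \<open>auto simp: H_def\<close>)
    also have "\<dots> = real n * (\<delta> / B)" by simp
    also have "\<dots> \<le> B * (\<delta> / B)" using assms by (intro mult_right_mono) auto
    finally show ?thesis using assms by simp
  qed
  ultimately show ?thesis unfolding G_def using M(2) by blast
qed

section \<open>Coordinates of the five classes, with blocks and prefixes treated alike as
  segments\<close>

definition segment :: "nat \<Rightarrow> nat \<Rightarrow> rvec \<Rightarrow> rvec" where
  "segment lo e x = vec e (\<lambda>j. x $ (lo + j))"

lemma block_eq_segment: "block ds i x = segment (sum_list (take i ds)) (ds ! i) x"
  by (simp add: block_def segment_def)

lemma vec_first_eq_segment: "vec_first x e = segment 0 e x"
  by (simp add: vec_first_def segment_def)

lemma block_bound: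
  assumes "block_lengths m ds" "i < length ds"
  shows "sum_list (take i ds) + ds ! i \<le> m" "1 \<le> ds ! i"
proof -
  have "sum_list (take (Suc i) ds) + sum_list (drop (Suc i) ds) = m"
    using assms by (metis append_take_drop_id block_lengths_def sum_list_append)
  then show "sum_list (take i ds) + ds ! i \<le> m"
    using assms by (simp add: take_Suc_conv_app_nth)
  show "1 \<le> ds ! i" using assms by (auto simp: block_lengths_def)
qed

lemma in_cube_vec_state: "x \<in> hypercube m a b \<Longrightarrow> in_cube m a b (vec_state m x)"
  by (auto simp: hypercube_def in_cube_def vec_state_def)

lemma approximable_lipschitz:
  assumes "a < b" "b - a \<le> 2 * B" "1 \<le> B" "e \<le> q" "1 \<le> q" "lo + e \<le> m" "1 \<le> e" "1 \<le> p"
    and lip: "\<And>x y. x \<in> hypercube e a b \<Longrightarrow> y \<in> hypercube e a b \<Longrightarrow> \<bar>f x - f y\<bar> \<le> B * lp_norm p (x - y)"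
  shows "approximable q m B (hypercube m a b) (\<lambda>x. f (segment lo e x))"
  unfolding approximable_def
proof (intro allI impI)
  fix \<eta> :: real assume \<eta>: "0 < \<eta> \<and> \<eta> \<le> 1"
  have "\<bar>f (vec e v) - f (vec e w)\<bar> \<le> B * (\<Sum>i<e. \<bar>v i - w i\<bar>)"
    if "in_cube e a b v" "in_cube e a b w" for v w
  proof -
    have "\<bar>f (vec e v) - f (vec e w)\<bar> \<le> B * lp_norm p (vec e v - vec e w)"
      using that by (intro lip) (auto simp: hypercube_def in_cube_def)
    also have "\<dots> \<le> B * dist1 e (vec e v) (vec e w)"
      using assms by (intro mult_left_mono lp_norm_le_dist1) auto
    also have "dist1 e (vec e v) (vec e w) = (\<Sum>i<e. \<bar>v i - w i\<bar>)" by (simp add: dist1_def)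
    finally show ?thesis .
  qed
  then obtain h where h: "scalar_prog m (grid_cost q B \<eta>) B h"
    "\<And>\<sigma>. in_cube m a b \<sigma> \<Longrightarrow> \<bar>h \<sigma> - f (vec e (\<lambda>i. \<sigma> (lo + i)))\<bar> \<le> \<eta>"
    using scalar_prog_lipschitz_block[of a b \<eta> B e q lo m "\<lambda>v. f (vec e v)"] assms(1-6) \<eta> by blast
  have "grid_cost q B \<eta> \<le> grid_cost q B (\<eta> / B)"
    using assms \<eta> by (intro grid_cost_antimono) (auto simp: divide_le_eq mult_le_cancel_left1)
  also have "\<dots> \<le> 4 * B * grid_cost q B (\<eta> / B)"
  proof -
    have "1 \<le> grid_cost q B (\<eta> / B)" using assms \<eta> by (intro grid_cost_ge_1) auto
    then show ?thesis using mult_right_mono[of 1 "4 * B" "grid_cost q B (\<eta> / B)"] assms by simp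
  qed
  finally have "scalar_prog m (4 * B * grid_cost q B (\<eta> / B)) B h"
    by (rule scalar_prog_mono[OF h(1)])
  moreover have "vec e (\<lambda>i. vec_state m x (lo + i)) = segment lo e x" for x
    using assms by (intro eq_vecI) (auto simp: segment_def vec_state_def)
  then have "\<bar>h (vec_state m x) - f (segment lo e x)\<bar> \<le> \<eta>" if "x \<in> hypercube m a b" for x
    using h(2)[OF in_cube_vec_state[OF that]] by simp
  ultimately show "\<exists>h. scalar_prog m (4 * B * grid_cost q B (\<eta> / B)) B h \<and>
      (\<forall>x\<in>hypercube m a b. \<bar>h (vec_state m x) - f (segment lo e x)\<bar> \<le> \<eta>)" by blast
qed

lemma fold_max: "fold (\<lambda>j z. max z (\<sigma> j)) js z = Max (insert z (\<sigma> ` set js))" for z :: "'a :: linorder"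
proof (induction js rule: rev_induct)
  case (snoc j js)
  have "max (Max (insert z (\<sigma> ` set js))) (\<sigma> j) = Max (insert (\<sigma> j) (insert z (\<sigma> ` set js)))"
    by (subst Max_insert) (auto simp: max.commute)
  then show ?case using snoc by (simp add: insert_commute)
qed simp

lemma fold_prod: "distinct js \<Longrightarrow> fold (\<lambda>j z. z * \<sigma> j) js z = z * (\<Prod>j\<in>set js. \<sigma> j)" for z :: "'a :: comm_monoid_mult"
  by (induction js rule: rev_induct) (auto simp: mult_ac)

lemma approximable_fold:
  fixes \<phi> :: "real \<Rightarrow> real \<Rightarrow> real"
  assumes "1 \<le> A" "A \<le> B" "2 \<le> q" "lo + e \<le> m" "real m \<le> B" "z \<in> {-A..A}" "Q \<subseteq> hypercube m (-A) A"
    and \<phi>: "\<And>x y. x \<in> {-A..A} \<Longrightarrow> y \<in> {-A..A} \<Longrightarrow> \<phi> x y \<in> {-A..A}"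
    and lip: "\<And>x y x' y'. x \<in> {-A..A} \<Longrightarrow> y \<in> {-A..A} \<Longrightarrow> x' \<in> {-A..A} \<Longrightarrow> y' \<in> {-A..A} \<Longrightarrow>
      \<bar>\<phi> x y - \<phi> x' y'\<bar> \<le> \<bar>x - x'\<bar> + \<bar>y - y'\<bar>"
    and f: "\<And>x. x \<in> Q \<Longrightarrow> fold (\<lambda>j z. \<phi> z (vec_state m x j)) [lo..<lo + e] z = f x"
  shows "approximable q m B Q f"
  unfolding approximable_def
proof (intro allI impI)
  fix \<eta> :: real assume "0 < \<eta> \<and> \<eta> \<le> 1"
  then obtain h where h: "scalar_prog m (4 * B * grid_cost q B (\<eta> / B)) B h"
    "\<And>\<sigma>. in_cube m (-A) A \<sigma> \<Longrightarrow> \<bar>h \<sigma> - fold (\<lambda>j x. \<phi> x (\<sigma> j)) [lo..<lo + e] z\<bar> \<le> \<eta>"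
    using scalar_prog_fold[of \<eta> A B q "lo + e" m z \<phi> lo] assms(1-6) \<phi> lip by blast
  have "\<bar>h (vec_state m x) - f x\<bar> \<le> \<eta>" if "x \<in> Q" for x
    using h(2)[of "vec_state m x"] in_cube_vec_state[of x m "-A" A] f[OF that] assms(7) that by auto
  then show "\<exists>h. scalar_prog m (4 * B * grid_cost q B (\<eta> / B)) B h \<and>
      (\<forall>x\<in>Q. \<bar>h (vec_state m x) - f x\<bar> \<le> \<eta>)"
    using h(1) by blast
qed

lemma image_vec_state_segment:
  assumes "lo + e \<le> m"
  shows "vec_state m x ` {lo..<lo + e} = (\<lambda>j. segment lo e x $ j) ` {..<e}"
proof -
  have "{lo..<lo + e} = (+) lo ` {..<e}"
    by (simp add: lessThan_atLeast0 image_add_atLeastLessThan add.commute)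
  then show ?thesis
    by (simp only: image_image) (rule image_cong, use assms in \<open>auto simp: segment_def vec_state_def\<close>)
qed

text \<open>On [-B,B] the number -B is neutral for the maximum, and this interval is closed under
  it. The neutral element does not change the result because a segment has at least one
  entry.\<close>

lemma approximable_max:
  assumes "1 \<le> B" "2 \<le> q" "lo + e \<le> m" "1 \<le> e" "real m \<le> B" "Q \<subseteq> hypercube m (-B) B"
  shows "approximable q m B Q (\<lambda>x. max_vec (segment lo e x))"
proof (rule approximable_fold[where \<phi> = max and A = B and z = "-B" and lo = lo and e = e])
  fix x assume x: "x \<in> Q"
  let ?S = "vec_state m x ` {lo..<lo + e}"
  have S: "finite ?S" "?S \<noteq> {}" using assms by auto
  have "-B \<le> y" if "y \<in> ?S" for y
    using in_cube_vec_state[of x m "-B" B] x assms that by (auto simp: in_cube_def)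
  then have "-B \<le> Max ?S" using S by (meson Max_in)
  then have "Max (insert (-B) ?S) = Max ?S" using S by (simp add: max_absorb2)
  moreover have "max_vec (segment lo e x) = Max ?S"
    unfolding image_vec_state_segment[OF assms(3)] by (simp add: max_vec_def segment_def)
  ultimately show "fold (\<lambda>j z. max z (vec_state m x j)) [lo..<lo + e] (-B) = max_vec (segment lo e x)"
    by (simp add: fold_max)
qed (use assms in auto)

text \<open>On [-1,1] multiplication stays inside and changes by at most |x - x'| + |y - y'|. Both
  properties fail on [-A,A] for A > 1.\<close>

lemma approximable_prod:
  assumes "1 \<le> B" "2 \<le> q" "lo + e \<le> m" "real m \<le> B" "Q \<subseteq> hypercube m (-1) 1"
  shows "approximable q m B Q (\<lambda>x. prod_vec (segment lo e x))"
proof (rule approximable_fold[where \<phi> = "(*)" and A = 1 and z = 1 and lo = lo and e = e])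
  fix x y x' y' :: real assume *: "x \<in> {-1..1}" "y \<in> {-1..1}" "x' \<in> {-1..1}" "y' \<in> {-1..1}"
  have "\<bar>x * y\<bar> \<le> 1 * 1" unfolding abs_mult using * by (intro mult_mono) auto
  then show "x * y \<in> {-1..1}" by auto
  have "x * y - x' * y' = (x - x') * y + x' * (y - y')" by (simp add: algebra_simps)
  moreover have "\<bar>(x - x') * y\<bar> \<le> \<bar>x - x'\<bar> * 1" "\<bar>x' * (y - y')\<bar> \<le> 1 * \<bar>y - y'\<bar>"
    unfolding abs_mult using * by (intro mult_mono; auto)+
  moreover have "\<bar>r\<bar> \<le> a + b" if "r = u + v" "\<bar>u\<bar> \<le> a * 1" "\<bar>v\<bar> \<le> 1 * b" for r u v a b :: real
    using that by linarith
  ultimately show "\<bar>x * y - x' * y'\<bar> \<le> \<bar>x - x'\<bar> + \<bar>y - y'\<bar>" by blast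
next
  fix x assume "x \<in> Q"
  have "prod_vec (segment lo e x) = (\<Prod>j\<in>{lo..<lo + e}. vec_state m x j)"
    using assms prod.shift_bounds_nat_ivl[of "vec_state m x" 0 lo e]
    by (simp add: prod_vec_def segment_def vec_state_def lessThan_atLeast0 add.commute)
  then show "fold (\<lambda>j z. z * vec_state m x j) [lo..<lo + e] 1 = prod_vec (segment lo e x)"
    by (simp add: fold_prod)
qed (use assms in auto)

lemma approximable_cong:
  assumes "approximable q m B Q f" "\<And>x. x \<in> Q \<Longrightarrow> f' x = f x"
  shows "approximable q m B Q f'"
  using assms unfolding approximable_def by simp

text \<open>The function classes bring their own dimension and endpoints for the cube. The two
  constant corner vectors identify the dimension and bound the endpoints.\<close>

lemma hypercube_subset_bounds:
  assumes "hypercube m' a b \<subseteq> hypercube m (-B) B" "a < b" "1 \<le> m"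
  shows "m' = m" "-B \<le> a" "b \<le> B"
proof -
  have *: "vec m' (\<lambda>_. a) \<in> hypercube m (-B) B" "vec m' (\<lambda>_. b) \<in> hypercube m (-B) B"
    by (intro subsetD[OF assms(1)]; use assms(2) in \<open>simp add: hypercube_def\<close>)+
  then show "m' = m" by (auto simp: hypercube_def dest!: carrier_vecD)
  with * assms(3) show "-B \<le> a" "b \<le> B" by (auto simp: hypercube_def dest!: spec[of _ 0])
qed

lemma hypercube_nonempty: "a < b \<Longrightarrow> \<exists>x. x \<in> hypercube m a b"
  by (intro exI[of _ "vec m (\<lambda>_. a)"]) (auto simp: hypercube_def)

lemma parallel_length:
  assumes "restrict (parallel ds f) Q \<in> cont_funs m Q n" "x \<in> Q"
  shows "length ds = n"
proof -
  have "restrict (parallel ds f) Q x \<in> carrier_vec n"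
    using assms unfolding cont_funs_def by blast
  then show ?thesis using assms(2) by (auto simp: parallel_def dest!: carrier_vecD)
qed

text \<open>The choice 2 c dominates both the block length c of the Lipschitz class and the two
  variables of a binary operation, so one exponent serves all five cases.\<close>

lemma approximable_coordinates:
  assumes "1 \<le> c" "1 \<le> B" "1 \<le> m" "real m \<le> B" "1 \<le> p"
    and Q: "is_hypercube m Q" "Q \<subseteq> hypercube m (-B) B"
    and g: "g \<in> cont_funs m Q n"
      "g \<in> lip_class c p Q B \<union> {restrict cum_max Q} \<union> {restrict cum_prod Q} \<union> max_class Q \<union> prod_class Q"
    and prod: "g \<in> prod_class Q \<union> {restrict cum_prod Q} \<Longrightarrow> Q \<subseteq> hypercube m (-1) 1"
    and "i < n"
  shows "approximable (2 * c) m B Q (\<lambda>x. g x $ i)"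
proof -
  have q: "2 \<le> 2 * c" "1 \<le> 2 * c" using assms(1) by auto
  have dim: "dim_vec x = m" if "x \<in> Q" for x
    using that Q(2) by (auto simp: hypercube_def dest!: subsetD carrier_vecD)
  \<comment> \<open>The output dimension n can only be read off a value of g: it is
    \<open>length ds\<close> for the parallelized classes and m for the cumulative maps.\<close>
  obtain x0 where x0: "x0 \<in> Q" using Q(1) hypercube_nonempty unfolding is_hypercube_def by metis
  have cum: "n = m" if "g = restrict f Q" "f = cum_max \<or> f = cum_prod" for f
  proof -
    have "g x0 \<in> carrier_vec n" using g(1) x0 unfolding cont_funs_def by blast
    then show ?thesis using that x0 dim by (auto simp: cum_max_def cum_prod_def dest!: carrier_vecD)
  qed
  consider "g \<in> lip_class c p Q B" | "g = restrict cum_max Q" | "g = restrict cum_prod Q"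
    | "g \<in> max_class Q" | "g \<in> prod_class Q" using g(2) by blast
  then show ?thesis
  proof cases
    case 1
    then obtain m' a b ds f where *: "a < b" "Q = hypercube m' a b" "block_lengths m' ds"
      "\<forall>e\<in>set ds. e \<le> c"
      "\<forall>i<length ds. \<forall>x\<in>hypercube (ds ! i) a b. \<forall>y\<in>hypercube (ds ! i) a b.
         \<bar>f i x - f i y\<bar> \<le> B * lp_norm p (x - y)"
      "g = restrict (parallel ds f) Q"
      unfolding lip_class_def by blast
    have m: "m' = m" "-B \<le> a" "b \<le> B"
      using hypercube_subset_bounds[of m' a b m B] * Q assms by auto
    have i: "i < length ds" using parallel_length[OF g(1)[unfolded *(6)] x0] \<open>i < n\<close> by simp
    have "ds ! i \<le> c" using *(4) i by (meson nth_mem)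
    then have ds: "ds ! i \<le> 2 * c" "b - a \<le> 2 * B" using m by linarith+
    show ?thesis
    proof (rule approximable_cong)
      show "approximable (2 * c) m B Q (\<lambda>x. f i (segment (sum_list (take i ds)) (ds ! i) x))"
        unfolding *(2) m(1) using *(5) i block_bound[OF *(3) i] m(1)
        by (intro approximable_lipschitz[where p = p, OF *(1) ds(2) assms(2) ds(1) q(2) _ _ assms(5)]) auto
    qed (use i in \<open>simp add: *(6) parallel_def block_eq_segment\<close>)
  next
    case 2
    have "i < m" using cum[of cum_max] 2 \<open>i < n\<close> by simp
    show ?thesis
    proof (rule approximable_cong)
      show "approximable (2 * c) m B Q (\<lambda>x. max_vec (segment 0 (Suc i) x))"
        using assms q \<open>i < m\<close> by (intro approximable_max) auto
    qed (use \<open>i < m\<close> dim in \<open>simp add: 2 cum_max_def vec_first_eq_segment\<close>)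
  next
    case 3
    have "i < m" using cum[of cum_prod] 3 \<open>i < n\<close> by simp
    show ?thesis
    proof (rule approximable_cong)
      show "approximable (2 * c) m B Q (\<lambda>x. prod_vec (segment 0 (Suc i) x))"
        using assms(2,4) prod 3 q \<open>i < m\<close> by (intro approximable_prod) auto
    qed (use \<open>i < m\<close> dim in \<open>simp add: 3 cum_prod_def vec_first_eq_segment\<close>)
  next
    case 4
    then obtain m' a b ds where *: "a < b" "Q = hypercube m' a b" "block_lengths m' ds"
      "g = restrict (parallel ds (\<lambda>_. max_vec)) Q"
      unfolding max_class_def by blast
    have m: "m' = m" using hypercube_subset_bounds[of m' a b m B] * Q assms by auto
    have i: "i < length ds" using parallel_length[OF g(1)[unfolded *(4)] x0] \<open>i < n\<close> by simp
    show ?thesis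
    proof (rule approximable_cong)
      show "approximable (2 * c) m B Q (\<lambda>x. max_vec (segment (sum_list (take i ds)) (ds ! i) x))"
        using assms q block_bound[OF *(3) i] m by (intro approximable_max) auto
    qed (use i in \<open>simp add: *(4) parallel_def block_eq_segment\<close>)
  next
    case 5
    then obtain m' a b ds where *: "a < b" "Q = hypercube m' a b" "block_lengths m' ds"
      "g = restrict (parallel ds (\<lambda>_. prod_vec)) Q"
      unfolding prod_class_def by blast
    have m: "m' = m" using hypercube_subset_bounds[of m' a b m B] * Q assms by auto
    have i: "i < length ds" using parallel_length[OF g(1)[unfolded *(4)] x0] \<open>i < n\<close> by simp
    show ?thesis
    proof (rule approximable_cong)
      show "approximable (2 * c) m B Q (\<lambda>x. prod_vec (segment (sum_list (take i ds)) (ds ! i) x))"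
        using assms(2,4) prod 5 q block_bound[OF *(3) i] m by (intro approximable_prod) auto
    qed (use i in \<open>simp add: *(4) parallel_def block_eq_segment\<close>)
  qed
qed

section \<open>Composing layers\<close>

text \<open>The induction closes because \<Lambda> (\<delta> j \<Lambda>^j) + \<delta> \<le>
  \<delta> (j + 1) \<Lambda>^(j + 1) for \<Lambda> \<ge> 1; this is cruder than the geometric sum
  but simpler to solve for \<delta>.\<close>

lemma compose_layers:
  fixes g :: "nat \<Rightarrow> rvec \<Rightarrow> rvec"
  assumes layer: "\<And>i. i \<in> {1..k} \<Longrightarrow> \<exists>h M. real M \<le> N \<and> net_fun w (D i) (D (i + 1)) M h \<and>
      (\<forall>x\<in>carrier_vec (D i). \<forall>y\<in>carrier_vec (D i). dist1 (D (i + 1)) (h x) (h y) \<le> \<Lambda> * dist1 (D i) x y) \<and>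
      (\<forall>x\<in>Q i. dist1 (D (i + 1)) (h x) (g i x) \<le> \<delta>)"
    and Q: "\<And>i. i \<in> {1..k} \<Longrightarrow> Q i \<subseteq> carrier_vec (D i)"
    and maps: "\<And>i. i \<in> {1..<k} \<Longrightarrow> g i ` Q i \<subseteq> Q (i + 1)"
    and "1 \<le> \<Lambda>" "0 \<le> \<delta>" "1 \<le> j"
  shows "j \<le> k \<Longrightarrow> \<exists>h M. real M \<le> real j * N \<and> net_fun w (D 1) (D (j + 1)) M h \<and>
    (\<forall>x\<in>Q 1. dist1 (D (j + 1)) (h x) (fold g [1..<j + 1] x) \<le> \<delta> * real j * \<Lambda> ^ j)"
  using \<open>1 \<le> j\<close>
proof (induction j rule: nat_induct_at_least)
  case base
  then obtain h M where h: "real M \<le> N" "net_fun w (D 1) (D 2) M h"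
    "\<forall>x\<in>Q 1. dist1 (D 2) (h x) (g 1 x) \<le> \<delta>"
    using layer[of 1] by (auto simp: numeral_2_eq_2)
  have "\<delta> * 1 \<le> \<delta> * \<Lambda>" using assms by (intro mult_left_mono) auto
  with h show ?case by (intro exI[of _ h] exI[of _ M]) (fastforce simp: numeral_2_eq_2)
next
  case (Suc j)
  then obtain h M where h: "real M \<le> real j * N" "net_fun w (D 1) (D (j + 1)) M h"
    "\<And>x. x \<in> Q 1 \<Longrightarrow> dist1 (D (j + 1)) (h x) (fold g [1..<j + 1] x) \<le> \<delta> * real j * \<Lambda> ^ j"
    by auto
  obtain h' M' where h': "real M' \<le> N" "net_fun w (D (j + 1)) (D (j + 2)) M' h'"
    "\<And>x y. x \<in> carrier_vec (D (j + 1)) \<Longrightarrow> y \<in> carrier_vec (D (j + 1)) \<Longrightarrow>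
      dist1 (D (j + 2)) (h' x) (h' y) \<le> \<Lambda> * dist1 (D (j + 1)) x y"
    "\<And>x. x \<in> Q (j + 1) \<Longrightarrow> dist1 (D (j + 2)) (h' x) (g (j + 1) x) \<le> \<delta>"
    using layer[of "j + 1"] Suc.prems by (auto simp: numeral_2_eq_2)
  have fold_Q: "l < k \<Longrightarrow> x \<in> Q 1 \<Longrightarrow> fold g [1..<l + 1] x \<in> Q (l + 1)" for l x
  proof (induction l)
    case (Suc l)
    then show ?case using maps[of "l + 1"] by auto
  qed simp
  have err: "dist1 (D (j + 2)) (h' (h x)) (fold g [1..<j + 2] x) \<le> \<delta> * real (Suc j) * \<Lambda> ^ Suc j"
    if x: "x \<in> Q 1" for x
  proof -
    \<comment> \<open>The exact intermediate value lies in \<open>Q (j + 1)\<close>, whereas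
      \<open>h x\<close> need not. The Lipschitz bound of h' leads from \<open>h x\<close> to y, and
      h' is compared with the exact map only at y.\<close>
    define y where "y = fold g [1..<j + 1] x"
    have y: "y \<in> Q (j + 1)" unfolding y_def using fold_Q[of j x] Suc.prems x by simp
    have "x \<in> carrier_vec (D 1)" using x Q[of 1] Suc by auto
    then have hx: "h x \<in> carrier_vec (D (j + 1))" using net_fun_carrier[OF h(2)] by blast
    have "y \<in> carrier_vec (D (j + 1))" using y Q[of "j + 1"] Suc.prems by auto
    from h'(3)[OF hx this] have "dist1 (D (j + 2)) (h' (h x)) (h' y) \<le> \<Lambda> * dist1 (D (j + 1)) (h x) y" .
    also have "\<dots> \<le> \<Lambda> * (\<delta> * real j * \<Lambda> ^ j)"
      using h(3)[OF x] assms unfolding y_def by (intro mult_left_mono) auto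
    finally have "dist1 (D (j + 2)) (h' (h x)) (g (j + 1) y) \<le> \<Lambda> * (\<delta> * real j * \<Lambda> ^ j) + \<delta>"
      using dist1_triangle[of "D (j + 2)" "h' (h x)" "g (j + 1) y" "h' y"] h'(4)[OF y] by linarith
    moreover have "\<delta> * 1 \<le> \<delta> * \<Lambda> ^ Suc j"
      using assms by (intro mult_left_mono one_le_power) auto
    moreover have "fold g [1..<j + 2] x = g (j + 1) y" by (simp add: y_def)
    ultimately show ?thesis by (simp add: algebra_simps)
  qed
  have "real (M + M') \<le> real (Suc j) * N" using h h' by (simp add: algebra_simps)
  moreover have "net_fun w (D 1) (D (Suc j + 1)) (M + M') (\<lambda>x. h' (h x))"
    using net_fun_compose[OF h(2) h'(2)] by simp
  ultimately show ?case using err by (intro exI[of _ "\<lambda>x. h' (h x)"] exI[of _ "M + M'"]) simp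
qed

theorem theorem1p2:
  fixes c k :: nat
    and D :: "nat \<Rightarrow> nat \<Rightarrow> nat"
    and Q :: "nat \<Rightarrow> nat \<Rightarrow> rvec set"
    and g :: "nat \<Rightarrow> nat \<Rightarrow> rvec \<Rightarrow> rvec"
    and p :: ereal
    and F :: "nat \<Rightarrow> rvec \<Rightarrow> rvec"
  assumes "1 \<le> c" and "1 \<le> k"
    and "\<And>d i. 1 \<le> d \<Longrightarrow> i \<in> {1..k+1} \<Longrightarrow> D d i \<in> {1..c * d ^ c}"
    and "\<And>d i. 1 \<le> d \<Longrightarrow> i \<in> {1..k} \<Longrightarrow> is_hypercube (D d i) (Q d i)"
    and "\<And>d i. 1 \<le> d \<Longrightarrow> i \<in> {1..k} \<Longrightarrow>
           Q d i \<subseteq> hypercube (D d i) (- (real c * real d ^ c)) (real c * real d ^ c)"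
    and "\<And>d i. 1 \<le> d \<Longrightarrow> i \<in> {1..k} \<Longrightarrow> g d i \<in> cont_funs (D d i) (Q d i) (D d (i + 1))"
    and "1 \<le> p"
    and "\<And>d i. 1 \<le> d \<Longrightarrow> i \<in> {1..k} \<Longrightarrow>
           g d i \<in> lip_class c p (Q d i) (real c * real d ^ c)
             \<union> {restrict cum_max (Q d i)} \<union> {restrict cum_prod (Q d i)}
             \<union> max_class (Q d i) \<union> prod_class (Q d i)"
    and "\<And>d i. 1 \<le> d \<Longrightarrow> i \<in> {1..<k} \<Longrightarrow> g d i ` Q d i \<subseteq> Q d (i + 1)"
    and "\<And>d i. 1 \<le> d \<Longrightarrow> i \<in> {1..k} \<Longrightarrow>
           g d i \<in> prod_class (Q d i) \<union> {restrict cum_prod (Q d i)} \<Longrightarrow>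
           Q d i \<subseteq> hypercube (D d i) (- 1) 1"
    and "\<And>d. 1 \<le> d \<Longrightarrow> F d \<in> cont_funs (D d 1) (Q d 1) (D d (k + 1))"
    and "\<And>d. 1 \<le> d \<Longrightarrow> F d = restrict (fold (g d) [1..<k+1]) (Q d 1)"
  shows "\<exists>K::nat. 1 \<le> K \<and>
    (\<forall>d\<ge>1. \<forall>\<epsilon>::real. 0 < \<epsilon> \<and> \<epsilon> \<le> 1 \<longrightarrow>
      (\<exists>\<Phi>\<in>networks.
        in_dim \<Phi> = D d 1 \<and> out_dim \<Phi> = D d (k + 1) \<and>
        realization \<Phi> \<in> cont_funs (D d 1) (carrier_vec (D d 1)) (D d (k + 1)) \<and>
        real (num_params \<Phi>) \<le> real K * real d ^ K * \<epsilon> powr (- 2 * real c) \<and>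
        (\<forall>x\<in>Q d 1. lp_norm p (realization \<Phi> x - F d x) \<le> \<epsilon>)))"
proof -
  define q where "q = 2 * c"
  have q: "1 \<le> q" using assms(1) by (simp add: q_def)
  \<comment> \<open>1560 = 10 * 12 * 13: the factor 10 comes from the depth of a layer, the others
    from w \<le> 12 B and w + 1 \<le> 13 B. The factor k in front counts the layers; the k inside
    the power comes from \<delta>.\<close>
  define C where "C = 1560 * k * (q + 3) * (7 * q * k) ^ q"
  \<comment> \<open>The total power of B. Depth and width contribute B^2 each; inside the q-th power
    stand B^2 from \<open>grid_cost\<close>, B^2 from \<delta> / B^2 and B^(2 k) from \<Lambda> ^
    k.\<close>
  define E where "E = 4 + (4 + 2 * k) * q"
  \<comment> \<open>Since B ^ E = c ^ E * d ^ (c * E), this number dominates the coefficient and the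
    exponent of d at once.\<close>
  define K where "K = C * c ^ E + c * E + 1"
  have "\<exists>\<Phi>\<in>networks.
        in_dim \<Phi> = D d 1 \<and> out_dim \<Phi> = D d (k + 1) \<and>
        realization \<Phi> \<in> cont_funs (D d 1) (carrier_vec (D d 1)) (D d (k + 1)) \<and>
        real (num_params \<Phi>) \<le> real K * real d ^ K * \<epsilon> powr (- 2 * real c) \<and>
        (\<forall>x\<in>Q d 1. lp_norm p (realization \<Phi> x - F d x) \<le> \<epsilon>)"
    if d: "1 \<le> d" and \<epsilon>: "0 < \<epsilon>" "\<epsilon> \<le> 1" for d and \<epsilon> :: real
  proof -
    define B where "B = real c * real d ^ c"
    have "1 * 1 \<le> B" unfolding B_def using assms(1) d by (intro mult_mono) auto
    then have B: "1 \<le> B" by simp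
    have D: "1 \<le> D d i" "D d i \<le> c * d ^ c" "real (D d i) \<le> B" if "i \<in> {1..k+1}" for i
    proof -
      show "1 \<le> D d i" "D d i \<le> c * d ^ c" using assms(3)[OF d that] by auto
      then have "real (D d i) \<le> real (c * d ^ c)" by (simp only: of_nat_le_iff)
      then show "real (D d i) \<le> B" by (simp add: B_def)
    qed
    define \<Lambda> where "\<Lambda> = B ^ 2"
    have \<Lambda>: "1 \<le> \<Lambda>" unfolding \<Lambda>_def using B by simp
    \<comment> \<open>Chosen so that the accumulated error \<delta> k \<Lambda>^k of
      \<open>compose_layers\<close> equals \<epsilon>.\<close>
    define \<delta> where "\<delta> = \<epsilon> / (real k * \<Lambda> ^ k)"
    have k\<Lambda>: "1 * 1 \<le> real k * \<Lambda> ^ k" using assms(2) \<Lambda> by (intro mult_mono) auto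
    then have \<delta>: "0 < \<delta>" "\<delta> \<le> 1" using \<epsilon> by (auto simp: \<delta>_def divide_le_eq)
    \<comment> \<open>Three times the register count m + n + 2 of a layer, with both dimensions at
      most c * d ^ c; one width then serves all layers.\<close>
    define w where "w = 6 * (c * d ^ c) + 6"
    define N where "N = 10 * B ^ 2 * grid_cost q B (\<delta> / B ^ 2)"
    have layer: "\<exists>h M. real M \<le> N \<and> net_fun w (D d i) (D d (i + 1)) M h \<and>
      (\<forall>x\<in>carrier_vec (D d i). \<forall>y\<in>carrier_vec (D d i).
        dist1 (D d (i + 1)) (h x) (h y) \<le> \<Lambda> * dist1 (D d i) x y) \<and>
      (\<forall>x\<in>Q d i. dist1 (D d (i + 1)) (h x) (g d i x) \<le> \<delta>)" if i: "i \<in> {1..k}" for i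
    proof -
      have i': "i \<in> {1..k+1}" "i + 1 \<in> {1..k+1}" using i by auto
      have "\<exists>h M. real M \<le> 10 * B ^ 2 * grid_cost q B (\<delta> / B ^ 2) \<and>
        net_fun (3 * (D d i + D d (i + 1) + 2)) (D d i) (D d (i + 1)) M h \<and>
        (\<forall>x\<in>carrier_vec (D d i). \<forall>y\<in>carrier_vec (D d i).
          dist1 (D d (i + 1)) (h x) (h y) \<le> B ^ 2 * dist1 (D d i) x y) \<and>
        (\<forall>x\<in>Q d i. dist1 (D d (i + 1)) (h x) (g d i x) \<le> \<delta>)"
      proof (rule approximable_layer[OF B D(1)[OF i'(1)] D(1)[OF i'(2)] D(3)[OF i'(1)] D(3)[OF i'(2)] \<delta> q])
        fix l assume "l < D d (i + 1)"
        then show "approximable q (D d i) B (Q d i) (\<lambda>x. g d i x $ l)"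
          unfolding q_def
          by (intro approximable_coordinates[OF assms(1) B D(1)[OF i'(1)] D(3)[OF i'(1)] assms(7)
            assms(4)[OF d i] assms(5)[OF d i, folded B_def] assms(6)[OF d i] assms(8)[OF d i, folded B_def]
            assms(10)[OF d i]])
      qed
      moreover have "3 * (D d i + D d (i + 1) + 2) \<le> w"
        using D(2)[OF i'(1)] D(2)[OF i'(2)] by (simp add: w_def)
      ultimately show ?thesis
        unfolding N_def \<Lambda>_def using net_fun_width_mono by blast
    qed
    have Q_carrier: "Q d i \<subseteq> carrier_vec (D d i)" if "i \<in> {1..k}" for i
      using assms(5)[OF d that] by (auto simp: hypercube_def)
    obtain h M where h: "real M \<le> real k * N" "net_fun w (D d 1) (D d (k + 1)) M h"
      "\<forall>x\<in>Q d 1. dist1 (D d (k + 1)) (h x) (fold (g d) [1..<k + 1] x) \<le> \<delta> * real k * \<Lambda> ^ k"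
      using compose_layers[of k N w "D d" \<Lambda> "Q d" "g d" \<delta> k, OF layer Q_carrier assms(9)[OF d] \<Lambda> _ assms(2)]
        \<delta> by auto
    obtain \<Phi> where \<Phi>: "net w (D d 1) (D d (k + 1)) \<Phi>" "length \<Phi> \<le> M"
      "\<And>x. x \<in> carrier_vec (D d 1) \<Longrightarrow> eval_layers \<Phi> x = h x"
      using h(2) unfolding net_fun_def by blast
    have \<Phi>_dims: "in_dim \<Phi> = D d 1" "out_dim \<Phi> = D d (k + 1)" using net_dims[OF \<Phi>(1)] by auto
    have "lp_norm p (realization \<Phi> x - F d x) \<le> \<epsilon>" if x: "x \<in> Q d 1" for x
    proof -
      have x': "x \<in> carrier_vec (D d 1)" using Q_carrier[of 1] x assms(2) by auto
      have F: "F d x \<in> carrier_vec (D d (k + 1))"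
        using assms(11)[OF d] x unfolding cont_funs_def by blast
      have "realization \<Phi> x = h x" using x' \<Phi>(3) by (simp add: realization_def \<Phi>_dims)
      then have "lp_norm p (realization \<Phi> x - F d x) \<le> dist1 (D d (k + 1)) (h x) (F d x)"
        using lp_norm_le_dist1[OF assms(7) D(1)[of "k + 1"] net_fun_carrier[OF h(2) x'] F] by simp
      also have "\<dots> = dist1 (D d (k + 1)) (h x) (fold (g d) [1..<k + 1] x)" using assms(12)[OF d] x by simp
      also have "\<dots> \<le> \<delta> * real k * \<Lambda> ^ k"
        using h(3) x by blast
      also have "\<delta> * real k * \<Lambda> ^ k = \<epsilon>" using assms(2) \<Lambda> by (simp add: \<delta>_def)
      finally show ?thesis .
    qed
    moreover have "real (num_params \<Phi>) \<le> real K * real d ^ K * \<epsilon> powr (- 2 * real c)"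
    proof -
      have "num_params \<Phi> \<le> M * (w * (w + 1))"
        using net_num_params[OF \<Phi>(1)] \<Phi>(2) by (meson le_trans mult_le_mono1)
      then have "real (num_params \<Phi>) \<le> real (M * (w * (w + 1)))" by (simp only: of_nat_le_iff)
      also have "\<dots> = real M * (real w * (real w + 1))" by (simp add: algebra_simps)
      also have "\<dots> \<le> (real k * N) * (12 * B * (13 * B))"
      proof -
        have "real w = 6 * B + 6" by (simp add: w_def B_def)
        then show ?thesis using h(1) B by (intro mult_mono) auto
      qed
      also have "\<dots> = 1560 * real k * B ^ 4 * grid_cost q B (\<delta> / B ^ 2)"
        by (simp add: N_def power4_eq_xxxx power2_eq_square)
      also have "grid_cost q B (\<delta> / B ^ 2) = (real q + 3) * (7 * real q * real k * B ^ (4 + 2 * k) / \<epsilon>) ^ q"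
      proof -
        have "7 * real q * B ^ 2 / (\<delta> / B ^ 2) = 7 * real q * real k * B ^ (4 + 2 * k) / \<epsilon>"
          by (simp add: \<delta>_def \<Lambda>_def power_add power_mult power4_eq_xxxx power2_eq_square)
        then show ?thesis by (simp add: grid_cost_def)
      qed
      also have "\<dots> = (real q + 3) * ((7 * real q * real k) ^ q * B ^ ((4 + 2 * k) * q) * (1 / \<epsilon> ^ q))"
        by (simp add: power_mult_distrib power_divide power_mult)
      also have "1560 * real k * B ^ 4 * \<dots> = real C * B ^ E * (1 / \<epsilon> ^ q)"
        by (simp add: C_def E_def power_add)
      also have "1 / \<epsilon> ^ q = \<epsilon> powr (- 2 * real c)"
        using \<epsilon> by (simp add: q_def powr_minus powr_realpow[symmetric] divide_inverse)
      also have "B ^ E = real (c ^ E) * real d ^ (c * E)"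
        by (simp add: B_def power_mult_distrib power_mult)
      also have "real C * (real (c ^ E) * real d ^ (c * E)) * \<epsilon> powr (- 2 * real c)
          \<le> real K * real d ^ K * \<epsilon> powr (- 2 * real c)"
      proof (rule mult_right_mono)
        have "real (C * c ^ E) * real d ^ (c * E) \<le> real K * real d ^ K"
          using d by (intro mult_mono power_increasing) (simp_all only: K_def of_nat_le_iff, auto)
        then show "real C * (real (c ^ E) * real d ^ (c * E)) \<le> real K * real d ^ K"
          by (simp add: mult.assoc)
      qed simp
      finally show ?thesis .
    qed
    ultimately show ?thesis
      using \<Phi>_dims net_networks[OF \<Phi>(1)] realization_cont_funs[OF \<Phi>(1)] by blast
  qed
  moreover have "1 \<le> K" by (simp add: K_def)
  ultimately show ?thesis by blast
qed

end
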